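(* Let $\mathcal{C}$ be a unary operadic category satisfying the blow-up axiom. Then there is an expanded category $\bar{\mathcal{C}}$, namely $\bar{\mathcal{C}} := \mathrm{sd}(U\mathcal{C})^{\mathrm{op}}$ (that is, this simplicial set is the nerve of a category), having the same objects as $\mathcal{C}$, in which every morphism $x\to z$ can be written uniquely as a pair $$x \xrightarrow{\ \langle f\rangle\ } y \xrightarrow{\ g\ } z ,$$ where $f$ is a morphism of $\mathcal{C}$ with domain $x$ and fiber $y$, and $g\colon y\to z$ is a morphism of $\mathcal{C}$. In particular, besides the maps of $\mathcal{C}$, $\bar{\mathcal{C}}$ has a map $\langle f\rangle\colon x\to \mathfrak{f}$ whenever $f\colon x\to y$ is a map in $\mathcal{C}$ with fiber $\mathfrak{f}$.
   Context: Small categories are identified with their nerves; a simplicial set is called a category if it is (isomorphic to) the nerve of a category. For a category $\mathcal{C}$, $\mathcal{C}_n$ is the set of chains of $n$ composable morphisms. Unary operadic categories. A category $\mathcal{C}$ is endowed with chosen local terminal objects if a terminal object has been specified in each connected component; $u,u',\dots$ denote chosen local terminal objects, and $\tau_x\colon x\to u$ is the unique map from $x$ to the chosen local terminal object in its component. Let $\mathrm{dec}_\top(\mathcal{C})=\coprod_{x}\mathcal{C}_{/x}$ be the sum of all slice categories, so $\mathrm{dec}_\top(\mathcal{C})_n=\mathcal{C}_{n+1}$. A unary operadic category is such a $\mathcal{C}$ together with a (fiber) functor $\varphi\colon \mathrm{dec}_\top(\mathcal{C})\to\mathcal{C}$, with components $\varphi_n\colon \mathcal{C}_{n+1}\to\mathcal{C}_n$;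 for a morphism $f$ of $\mathcal{C}$ the object $\varphi_0(f)$ is called the fiber of $f$, and for $x\xrightarrow{g}y\xrightarrow{f}z$ we get $\varphi_1(g\colon fg\to f)\colon\varphi_0(fg)\to\varphi_0(f)$. The axioms are: (U1) $\varphi_0(\mathrm{id}_x)$ is a chosen local terminal object for each $x$; (U2) $\varphi_0(\tau_x)=x$ and $\varphi_1(f\colon\tau_x\to\tau_y)=f$ for each $f\colon x\to y$; (U3) for $a\xrightarrow{h}b\xrightarrow{g}c\xrightarrow{f}x$ one has $\varphi_0(\varphi_1(g\colon fg\to f))=\varphi_0(g)$ and $\varphi_1(h\colon gh\to g)=\varphi_1\bigl(\varphi_1(h\colon fgh\to fg)\colon \varphi_1(gh\colon fgh\to f)\to\varphi_1(g\colon fg\to f)\bigr)$. Blow-up axiom: $\varphi$ is a discrete opfibration, i.e. for every $f\colon a\to x$ in $\mathcal{C}$ and every $p\colon\varphi_0(f)\to z$ in $\mathcal{C}$ there is a unique factorization $f=hk$ with $\varphi_1(k\colon f\to h)=p$. Undecking. $X=U\mathcal{C}$ is the simplicial set with $X_n\subset\mathcal{C}_n$ the set of chains $x_0\to x_1\to\cdots\to x_{n-1}\to u$ ending in a chosen local terminal object. All face and degeneracy operators are those of the nerve of $\mathcal{C}$, except that the top face $d_n^X\colon X_n\to X_{n-1}$ is the composite $\varphi_{n-1}s_{n-1}d_n$ (drop $u$, repeat the last remaining object $x_{n-1}$, and take fibers over $x_{n-1}$). Edgewise subdivision. $\mathrm{sd}(X)=X\circ Q^{\mathrm{op}}$, where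 $Q\colon\Delta\to\Delta$, $Q([n])=[n]^{\mathrm{op}}\star[n]\cong[2n+1]$, and for $f\colon[n]\to[m]$: $Q(f)(t)=m-f(n-t)$ if $t\le n$ and $Q(f)(t)=m+1+f(t-n-1)$ if $t\ge n+1$. So $\mathrm{sd}(X)_n=X_{2n+1}$; a $1$-simplex $\sigma\in X_3$ of $\mathrm{sd}(X)$ has source $d_0d_3\sigma$ and target $d_1d_2\sigma$ (these are reversed in $\mathrm{sd}(X)^{\mathrm{op}}$). Identifications in $\bar{\mathcal{C}}=\mathrm{sd}(X)^{\mathrm{op}}$: the object $x$ of $\mathcal{C}$ corresponds to $(\tau_x\colon x\to u)\in X_1$; a map $g\colon x\to y$ of $\mathcal{C}$ is regarded as the morphism $x\to y$ of $\bar{\mathcal{C}}$ given by $s_2(x\xrightarrow{g}y\to u)\in X_3$; for $f\colon x\to w$ in $\mathcal{C}$ with fiber $y$, $\langle f\rangle\colon x\to y$ is the morphism of $\bar{\mathcal{C}}$ given by $s_0(x\xrightarrow{f}w\to u)\in X_3$. The pair displayed in the claim represents the composite $g\circ\langle f\rangle$. *)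

theory Defs
  imports Main
begin

section \<open>Small categories and functors\<close>

record ('o, 'a) cat =
  Obj :: "'o set"
  Arr :: "'a set"
  Dom :: "'a \<Rightarrow> 'o"
  Cod :: "'a \<Rightarrow> 'o"
  Ident :: "'o \<Rightarrow> 'a"
  Comp :: "'a \<Rightarrow> 'a \<Rightarrow> 'a"  \<comment> \<open>\<open>Comp C f g\<close> is \<open>f\<close> after \<open>g\<close>\<close>

definition hom :: "('o, 'a) cat \<Rightarrow> 'o \<Rightarrow> 'o \<Rightarrow> 'a set" where
  "hom C x y = {f \<in> Arr C. Dom C f = x \<and> Cod C f = y}"

locale category =
  fixes C :: "('o, 'a) cat"
  assumes Dom_in_Obj: "f \<in> Arr C \<Longrightarrow> Dom C f \<in> Obj C"
    and Cod_in_Obj: "f \<in> Arr C \<Longrightarrow> Cod C f \<in> Obj C"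
    and Ident_in_hom: "x \<in> Obj C \<Longrightarrow> Ident C x \<in> hom C x x"
    and Comp_in_hom: "\<lbrakk>g \<in> hom C x y; f \<in> hom C y z\<rbrakk> \<Longrightarrow> Comp C f g \<in> hom C x z"
    and Comp_Ident_left: "f \<in> hom C x y \<Longrightarrow> Comp C (Ident C y) f = f"
    and Comp_Ident_right: "f \<in> hom C x y \<Longrightarrow> Comp C f (Ident C x) = f"
    and Comp_assoc: "\<lbrakk>h \<in> hom C w x; g \<in> hom C x y; f \<in> hom C y z\<rbrakk> \<Longrightarrow>
          Comp C (Comp C f g) h = Comp C f (Comp C g h)"

record ('o, 'a, 'p, 'b) func =
  fobj :: "'o \<Rightarrow> 'p"
  farr :: "'a \<Rightarrow> 'b"

definition is_functor ::
    "('o, 'a) cat \<Rightarrow> ('p, 'b) cat \<Rightarrow> ('o, 'a, 'p, 'b) func \<Rightarrow> bool" where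
  "is_functor C D F \<longleftrightarrow>
     (\<forall>x\<in>Obj C. fobj F x \<in> Obj D) \<and>
     (\<forall>f\<in>Arr C. farr F f \<in> hom D (fobj F (Dom C f)) (fobj F (Cod C f))) \<and>
     (\<forall>x\<in>Obj C. farr F (Ident C x) = Ident D (fobj F x)) \<and>
     (\<forall>f\<in>Arr C. \<forall>g\<in>Arr C. Cod C g = Dom C f \<longrightarrow>
        farr F (Comp C f g) = Comp D (farr F f) (farr F g))"

definition discrete_opfibration ::
    "('o, 'a) cat \<Rightarrow> ('p, 'b) cat \<Rightarrow> ('o, 'a, 'p, 'b) func \<Rightarrow> bool" where
  "discrete_opfibration E B F \<longleftrightarrow> is_functor E B F \<and>
     (\<forall>e\<in>Obj E. \<forall>p\<in>Arr B. Dom B p = fobj F e \<longrightarrow>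
        (\<exists>!q. q \<in> Arr E \<and> Dom E q = e \<and> farr F q = p))"


section \<open>Simplicial sets\<close>

text \<open>The maps of the simplex category from $[m]$ to $[n]$ are represented by functions on all
  natural numbers, of which only the restriction to \<open>{..m}\<close> matters.\<close>

definition delta_map :: "nat \<Rightarrow> nat \<Rightarrow> (nat \<Rightarrow> nat) \<Rightarrow> bool" where
  "delta_map m n \<alpha> \<longleftrightarrow> mono_on {..m} \<alpha> \<and> \<alpha> ` {..m} \<subseteq> {..n}"

definition coface :: "nat \<Rightarrow> nat \<Rightarrow> nat" where
  "coface i t = (if t < i then t else Suc t)"

definition codeg :: "nat \<Rightarrow> nat \<Rightarrow> nat" where
  "codeg i t = (if t \<le> i then t else t - 1)"

text \<open>For \<open>\<alpha>\<close> from $[m]$ to $[n]$, \<open>act X m n \<alpha>\<close> is the induced map from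
  \<open>Simp X n\<close> to \<open>Simp X m\<close>.\<close>

record 'x sset =
  Simp :: "nat \<Rightarrow> 'x set"
  act :: "nat \<Rightarrow> nat \<Rightarrow> (nat \<Rightarrow> nat) \<Rightarrow> 'x \<Rightarrow> 'x"

definition face :: "'x sset \<Rightarrow> nat \<Rightarrow> nat \<Rightarrow> 'x \<Rightarrow> 'x" where
  "face X n i = act X (n - 1) n (coface i)"

definition degen :: "'x sset \<Rightarrow> nat \<Rightarrow> nat \<Rightarrow> 'x \<Rightarrow> 'x" where
  "degen X n i = act X (Suc n) n (codeg i)"

definition simplicial_set :: "'x sset \<Rightarrow> bool" where
  "simplicial_set X \<longleftrightarrow>
     (\<forall>m n \<alpha>. delta_map m n \<alpha> \<longrightarrow> act X m n \<alpha> ` Simp X n \<subseteq> Simp X m) \<and>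
     (\<forall>m n \<alpha> \<beta>. delta_map m n \<alpha> \<longrightarrow> (\<forall>t\<le>m. \<alpha> t = \<beta> t) \<longrightarrow>
        (\<forall>s\<in>Simp X n. act X m n \<alpha> s = act X m n \<beta> s)) \<and>
     (\<forall>n. \<forall>s\<in>Simp X n. act X n n id s = s) \<and>
     (\<forall>l m n \<alpha> \<beta>. delta_map l m \<beta> \<longrightarrow> delta_map m n \<alpha> \<longrightarrow>
        (\<forall>s\<in>Simp X n. act X l n (\<alpha> \<circ> \<beta>) s = act X l m \<beta> (act X m n \<alpha> s)))"

definition sset_iso :: "'x sset \<Rightarrow> 'y sset \<Rightarrow> (nat \<Rightarrow> 'x \<Rightarrow> 'y) \<Rightarrow> bool" where
  "sset_iso X Y \<theta> \<longleftrightarrow> simplicial_set X \<and> simplicial_set Y \<and>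
     (\<forall>n. bij_betw (\<theta> n) (Simp X n) (Simp Y n)) \<and>
     (\<forall>m n \<alpha>. delta_map m n \<alpha> \<longrightarrow>
        (\<forall>s\<in>Simp X n. \<theta> m (act X m n \<alpha> s) = act Y m n \<alpha> (\<theta> n s)))"

definition op_sset :: "'x sset \<Rightarrow> 'x sset" where
  "op_sset X = \<lparr>Simp = Simp X, act = (\<lambda>m n \<alpha>. act X m n (\<lambda>t. n - \<alpha> (m - t)))\<rparr>"

text \<open>\<open>Qmap n m f\<close> is the value of $Q$ on \<open>f\<close> from $[n]$ to $[m]$, a map from $[2n+1]$ to
  $[2m+1]$.\<close>

definition Qmap :: "nat \<Rightarrow> nat \<Rightarrow> (nat \<Rightarrow> nat) \<Rightarrow> nat \<Rightarrow> nat" where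
  "Qmap n m f t = (if t \<le> n then m - f (n - t) else m + 1 + f (t - n - 1))"

definition sd :: "'x sset \<Rightarrow> 'x sset" where
  "sd X = \<lparr>Simp = (\<lambda>n. Simp X (2 * n + 1)),
           act = (\<lambda>m n \<alpha>. act X (2 * m + 1) (2 * n + 1) (Qmap m n \<alpha>))\<rparr>"


section \<open>Nerves\<close>

text \<open>A chain of $n$ composable arrows is a pair \<open>(x, fs)\<close> of its initial object and the list
  of its arrows, in the order in which they are traversed.\<close>

fun chain :: "('o, 'a) cat \<Rightarrow> 'o \<Rightarrow> 'a list \<Rightarrow> bool" where
  "chain C x [] \<longleftrightarrow> x \<in> Obj C"
| "chain C x (f # fs) \<longleftrightarrow> f \<in> Arr C \<and> Dom C f = x \<and> chain C (Cod C f) fs"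

fun path_comp :: "('o, 'a) cat \<Rightarrow> 'o \<Rightarrow> 'a list \<Rightarrow> 'a" where
  "path_comp C x [] = Ident C x"
| "path_comp C x [f] = f"
| "path_comp C x (f # g # fs) = Comp C (path_comp C (Cod C f) (g # fs)) f"

fun vertex :: "('o, 'a) cat \<Rightarrow> 'o \<times> 'a list \<Rightarrow> nat \<Rightarrow> 'o" where
  "vertex C (x, fs) i = (if i = 0 then x else Cod C (fs ! (i - 1)))"

text \<open>\<open>edge C s i j\<close> is the composite arrow from vertex \<open>i\<close> to vertex \<open>j\<close>, for \<open>i \<le> j\<close>.\<close>

definition edge :: "('o, 'a) cat \<Rightarrow> 'o \<times> 'a list \<Rightarrow> nat \<Rightarrow> nat \<Rightarrow> 'a" where
  "edge C s i j = path_comp C (vertex C s i) (take (j - i) (drop i (snd s)))"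

definition nerve :: "('o, 'a) cat \<Rightarrow> ('o \<times> 'a list) sset" where
  "nerve C = \<lparr>Simp = (\<lambda>n. {(x, fs). length fs = n \<and> chain C x fs}),
              act = (\<lambda>m n \<alpha> s. (vertex C s (\<alpha> 0),
                       map (\<lambda>i. edge C s (\<alpha> i) (\<alpha> (Suc i))) [0..<m]))\<rparr>"

definition nerve_map :: "('o, 'a, 'p, 'b) func \<Rightarrow> 'o \<times> 'a list \<Rightarrow> 'p \<times> 'b list" where
  "nerve_map F s = (fobj F (fst s), map (farr F) (snd s))"


section \<open>Unary operadic categories\<close>

text \<open>The sum of all slices of \<open>C\<close>. The arrow \<open>(g, f)\<close>, for \<open>g\<close> and \<open>f\<close> composable, is the
  triangle $g \colon fg \to f$ in the slice over the codomain of \<open>f\<close>.\<close>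

definition dec :: "('o, 'a) cat \<Rightarrow> ('a, 'a \<times> 'a) cat" where
  "dec C = \<lparr>Obj = Arr C,
            Arr = {(g, f). g \<in> Arr C \<and> f \<in> Arr C \<and> Cod C g = Dom C f},
            Dom = (\<lambda>(g, f). Comp C f g),
            Cod = (\<lambda>(g, f). f),
            Ident = (\<lambda>f. (Ident C (Dom C f), f)),
            Comp = (\<lambda>(g, f) (h, k). (Comp C g h, f))\<rparr>"

text \<open>The identification of $\mathcal{C}_{n+1}$ with the $n$-simplices of the nerve of
  \<open>dec C\<close>: every vertex and every arrow is taken over the last vertex.\<close>

definition chain_to_dec ::
    "('o, 'a) cat \<Rightarrow> nat \<Rightarrow> 'o \<times> 'a list \<Rightarrow> 'a \<times> ('a \<times> 'a) list" where
  "chain_to_dec C n s = (edge C s 0 (Suc n),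
     map (\<lambda>i. (edge C s i (Suc i), edge C s (Suc i) (Suc n))) [0..<n])"

definition phi ::
    "('o, 'a) cat \<Rightarrow> ('a, 'a \<times> 'a, 'o, 'a) func \<Rightarrow> nat \<Rightarrow> 'o \<times> 'a list \<Rightarrow> 'o \<times> 'a list" where
  "phi C \<Phi> n s = nerve_map \<Phi> (chain_to_dec C n s)"

definition connected_in :: "('o, 'a) cat \<Rightarrow> 'o \<Rightarrow> 'o \<Rightarrow> bool" where
  "connected_in C = equivclp (\<lambda>x y. hom C x y \<noteq> {})"

definition chosen_local_terminals :: "('o, 'a) cat \<Rightarrow> 'o set \<Rightarrow> bool" where
  "chosen_local_terminals C T \<longleftrightarrow> T \<subseteq> Obj C \<and>
     (\<forall>x\<in>Obj C. \<exists>!u. u \<in> T \<and> connected_in C x u) \<and>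
     (\<forall>u\<in>T. \<forall>x\<in>Obj C. connected_in C x u \<longrightarrow> (\<exists>!f. f \<in> hom C x u))"

definition tau :: "('o, 'a) cat \<Rightarrow> 'o set \<Rightarrow> 'o \<Rightarrow> 'a" where
  "tau C T x = (THE f. f \<in> Arr C \<and> Dom C f = x \<and> Cod C f \<in> T)"

locale unary_operadic_category = category C
  for C :: "('o, 'a) cat" +
  fixes T :: "'o set"
    and \<Phi> :: "('a, 'a \<times> 'a, 'o, 'a) func"
  assumes chosen: "chosen_local_terminals C T"
    and fiber_functor: "is_functor (dec C) C \<Phi>"
    and U1: "x \<in> Obj C \<Longrightarrow> fobj \<Phi> (Ident C x) \<in> T"
    and U2_obj: "x \<in> Obj C \<Longrightarrow> fobj \<Phi> (tau C T x) = x"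
    and U2_arr: "f \<in> hom C x y \<Longrightarrow> farr \<Phi> (f, tau C T y) = f"
    and U3_obj: "\<lbrakk>g \<in> hom C b c; f \<in> hom C c x\<rbrakk> \<Longrightarrow>
          fobj \<Phi> (farr \<Phi> (g, f)) = fobj \<Phi> g"
    and U3_arr: "\<lbrakk>h \<in> hom C a b; g \<in> hom C b c; f \<in> hom C c x\<rbrakk> \<Longrightarrow>
          farr \<Phi> (h, g) = farr \<Phi> (farr \<Phi> (h, Comp C f g), farr \<Phi> (g, f))"

text \<open>Since \<open>Dom (dec C) (k, h) = Comp C h k\<close>, lifts of \<open>p\<close> with domain \<open>f\<close> are
  factorizations $f = hk$ with $\varphi_1(k \colon f \to h) = p$.\<close>

definition blow_up :: "('o, 'a) cat \<Rightarrow> ('a, 'a \<times> 'a, 'o, 'a) func \<Rightarrow> bool" where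
  "blow_up C \<Phi> \<longleftrightarrow> discrete_opfibration (dec C) C \<Phi>"


section \<open>Undecking and the expanded category\<close>

definition top_face ::
    "('o, 'a) cat \<Rightarrow> ('a, 'a \<times> 'a, 'o, 'a) func \<Rightarrow> nat \<Rightarrow> 'o \<times> 'a list \<Rightarrow> 'o \<times> 'a list" where
  "top_face C \<Phi> n s =
     phi C \<Phi> (n - 1) (degen (nerve C) (n - 1) (n - 1) (face (nerve C) n n s))"

text \<open>\<open>top_faces C \<Phi> k d\<close> goes from degree \<open>k + d\<close> to degree \<open>k\<close> by \<open>d\<close> top faces.\<close>

fun top_faces ::
    "('o, 'a) cat \<Rightarrow> ('a, 'a \<times> 'a, 'o, 'a) func \<Rightarrow> nat \<Rightarrow> nat \<Rightarrow> 'o \<times> 'a list \<Rightarrow> 'o \<times> 'a list" where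
  "top_faces C \<Phi> k 0 s = s"
| "top_faces C \<Phi> k (Suc d) s = top_faces C \<Phi> k d (top_face C \<Phi> (k + Suc d) s)"

text \<open>Every map \<open>\<alpha>\<close> from $[m]$ to $[n]$ factors uniquely as a top-preserving map from $[m]$ to
  $[\alpha(m)]$, which is a composite of non-top cofaces and codegeneracies, followed by the initial
  inclusion of $[\alpha(m)]$ in $[n]$, which is a composite of top cofaces. So prescribing the
  nerve operators for all faces and degeneracies except the top faces, and \<open>top_face\<close>
  for these, determines the action of every \<open>\<alpha>\<close> as below.\<close>

definition undeck ::
    "('o, 'a) cat \<Rightarrow> 'o set \<Rightarrow> ('a, 'a \<times> 'a, 'o, 'a) func \<Rightarrow> ('o \<times> 'a list) sset" where
  "undeck C T \<Phi> = \<lparr>Simp = (\<lambda>n. {s \<in> Simp (nerve C) n. vertex C s n \<in> T}),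
     act = (\<lambda>m n \<alpha> s. act (nerve C) m (\<alpha> m) \<alpha> (top_faces C \<Phi> (\<alpha> m) (n - \<alpha> m) s))\<rparr>"

lemma undeck_degen: "degen (undeck C T \<Phi>) n i s = degen (nerve C) n i s" if "i \<le> n"
  using that by (simp add: degen_def undeck_def codeg_def nerve_def)

lemma undeck_face: "face (undeck C T \<Phi>) n i s = face (nerve C) n i s" if "i < n"
  using that by (simp add: face_def undeck_def coface_def nerve_def)

lemma undeck_top_face: "face (undeck C T \<Phi>) n n s = top_face C \<Phi> n s" if n: "n \<ge> 1"
proof -
  obtain k where k: "n = Suc k" using n by (cases n) auto
  obtain y fs where t: "top_face C \<Phi> n s = (y, fs)" by fastforce
  have len: "length fs = k"
    using arg_cong[OF t, of "\<lambda>t. length (snd t)"]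
    by (simp add: k top_face_def phi_def nerve_map_def chain_to_dec_def)
  have "path_comp C z (take (Suc 0) (drop i fs)) = fs ! i" if "i < k" for i z
    using that len by (simp add: Cons_nth_drop_Suc[symmetric])
  then have "map (\<lambda>i. edge C (y, fs) i (Suc i)) [0..<k] = fs"
    by (intro nth_equalityI) (simp_all add: edge_def len)
  moreover have "map (\<lambda>i. edge C (y, fs) (coface n i) (coface n (Suc i))) [0..<k]
      = map (\<lambda>i. edge C (y, fs) i (Suc i)) [0..<k]"
    by (simp add: k coface_def)
  ultimately show ?thesis
    using t by (simp add: face_def undeck_def nerve_def k coface_def)
qed

definition expanded ::
    "('o, 'a) cat \<Rightarrow> 'o set \<Rightarrow> ('a, 'a \<times> 'a, 'o, 'a) func \<Rightarrow> ('o \<times> 'a list) sset" where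
  "expanded C T \<Phi> = op_sset (sd (undeck C T \<Phi>))"

text \<open>The $0$-simplex of the expanded category for an object \<open>x\<close>, and its $1$-simplices for an
  arrow \<open>g\<close> of \<open>C\<close> and for the angle of an arrow \<open>f\<close>.\<close>

definition ex_obj :: "('o, 'a) cat \<Rightarrow> 'o set \<Rightarrow> 'o \<Rightarrow> 'o \<times> 'a list" where
  "ex_obj C T x = (x, [tau C T x])"

definition ex_arr ::
    "('o, 'a) cat \<Rightarrow> 'o set \<Rightarrow> ('a, 'a \<times> 'a, 'o, 'a) func \<Rightarrow> 'a \<Rightarrow> 'o \<times> 'a list" where
  "ex_arr C T \<Phi> g = degen (undeck C T \<Phi>) 2 2 (Dom C g, [g, tau C T (Cod C g)])"

definition ex_angle ::
    "('o, 'a) cat \<Rightarrow> 'o set \<Rightarrow> ('a, 'a \<times> 'a, 'o, 'a) func \<Rightarrow> 'a \<Rightarrow> 'o \<times> 'a list" where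
  "ex_angle C T \<Phi> f = degen (undeck C T \<Phi>) 2 0 (Dom C f, [f, tau C T (Cod C f)])"

end

theory Submission
  imports Defs
begin

text \<open>A simplicial set is the nerve of a category as soon as every $(n+1)$-simplex is uniquely glued
  from its first edge and its zeroth face along a vertex. An $(n+1)$-simplex of the expanded category
  is a chain $x \to y_0 \to \cdots \to y_{2n+1} \to u$. Its first edge is
  $x \to y_0 \to y_{2n+1} \to u$, and its zeroth face is the chain of fibers of the arrows
  $y_i \to y_{2n+1}$. So the chain is recovered by lifting its fibers, starting at the arrow
  $y_0 \to y_{2n+1}$, along the discrete opfibration $\varphi$. The lift ends at an arrow whose fiber is
  a chosen local terminal object, and the blow-up axiom forces such an arrow to be an identity.\<close>

section \<open>Nerves\<close>

text \<open>The obstacle is that the operators of the undecking are prescribed piecewise: top faces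
  take fibers, all others come from the nerve of \<open>C\<close>. The single formula
  \<open>fiber_chain\<close> removes the case distinction by always taking fibers over the image of
  the top vertex. In that formula (U1) keeps the end of the chain in \<open>T\<close>, (U2) gives
  agreement with the nerve when the top is preserved, and (U3) collapses fibers of fibers, which is
  functoriality. Fibers enter the zeroth face because, in the opposite of the subdivision, this face
  deletes both ends of the chain, so that the top moves from u to y_{2n+1}. A morphism of the
  expanded category is a chain x -> y -> w -> u with arrows a, b and the forced last one, hence a
  composable pair (a, b); its target is the fiber of b. The pair in the theorem is f = ba and g =
  phi(a, b), and going back from (f, g) to (a, b) is again a lift along the fiber functor.\<close>

definition diagram ::
    "('o, 'a) cat \<Rightarrow> nat \<Rightarrow> (nat \<Rightarrow> 'o) \<Rightarrow> (nat \<Rightarrow> nat \<Rightarrow> 'a) \<Rightarrow> bool" where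
  "diagram C n v e \<longleftrightarrow>
     (\<forall>i\<le>n. v i \<in> Obj C \<and> e i i = Ident C (v i)) \<and>
     (\<forall>i j. i \<le> j \<longrightarrow> j \<le> n \<longrightarrow> e i j \<in> hom C (v i) (v j)) \<and>
     (\<forall>i j k. i \<le> j \<longrightarrow> j \<le> k \<longrightarrow> k \<le> n \<longrightarrow> Comp C (e j k) (e i j) = e i k)"

definition diagram_chain :: "nat \<Rightarrow> (nat \<Rightarrow> 'o) \<Rightarrow> (nat \<Rightarrow> nat \<Rightarrow> 'a) \<Rightarrow> 'o \<times> 'a list" where
  "diagram_chain n v e = (v 0, map (\<lambda>i. e i (Suc i)) [0..<n])"

lemma diagram_chain_cong:
  assumes "v 0 = v' 0" "\<And>i. i < n \<Longrightarrow> e i (Suc i) = e' i (Suc i)"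
  shows "diagram_chain n v e = diagram_chain n v' e'"
  using assms by (simp add: diagram_chain_def)

lemma delta_map_le: "delta_map m n \<alpha> \<Longrightarrow> i \<le> m \<Longrightarrow> \<alpha> i \<le> n"
  by (auto simp: delta_map_def)

lemma delta_map_mono: "delta_map m n \<alpha> \<Longrightarrow> i \<le> j \<Longrightarrow> j \<le> m \<Longrightarrow> \<alpha> i \<le> \<alpha> j"
  by (auto simp: delta_map_def mono_on_def)

lemma delta_mapI:
  "(\<And>i j. i \<le> j \<Longrightarrow> j \<le> m \<Longrightarrow> \<alpha> i \<le> \<alpha> j) \<Longrightarrow> \<alpha> m \<le> n \<Longrightarrow> delta_map m n \<alpha>"
  by (fastforce simp: delta_map_def mono_on_def)

lemma delta_map_comp: "delta_map l m \<beta> \<Longrightarrow> delta_map m n \<alpha> \<Longrightarrow> delta_map l n (\<alpha> \<circ> \<beta>)"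
  by (auto simp: delta_map_def mono_on_def image_subset_iff)

lemma delta_map_id: "m \<le> n \<Longrightarrow> delta_map m n id"
  by (auto intro: delta_mapI)

lemma diagram_reindex:
  assumes "diagram C n v e" "delta_map m n \<alpha>"
  shows "diagram C m (\<lambda>i. v (\<alpha> i)) (\<lambda>i j. e (\<alpha> i) (\<alpha> j))"
  using assms unfolding diagram_def by (simp add: delta_map_le delta_map_mono)

lemma edge_Suc:
  assumes "s \<in> Simp (nerve C) n" "i < n"
  shows "edge C s i (Suc i) = snd s ! i"
  using assms by (auto simp: edge_def nerve_def Cons_nth_drop_Suc[symmetric])

lemma chain_nth:
  assumes "chain C x fs" "i < length fs"
  shows "fs ! i \<in> Arr C \<and> Dom C (fs ! i) = vertex C (x, fs) i \<and> Cod C (fs ! i) = vertex C (x, fs) (Suc i)"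
  using assms
proof (induction fs arbitrary: x i)
  case (Cons f fs)
  show ?case
  proof (cases i)
    case (Suc j)
    with Cons show ?thesis by (cases j) fastforce+
  qed (use Cons in auto)
qed simp

lemma edge_refl [simp]: "edge C s i i = Ident C (vertex C s i)"
  by (simp add: edge_def)

text \<open>Every nerve operator restricts a functor on the poset [n]. Keeping all composite edges
  makes restriction along \<alpha> a substitution, while \<open>diagram_chain_cong\<close> compares
  two results on the starting object and the adjacent arrows only.\<close>

lemma nerve_act: "act (nerve C) m n \<alpha> s =
    diagram_chain m (\<lambda>i. vertex C s (\<alpha> i)) (\<lambda>i j. edge C s (\<alpha> i) (\<alpha> j))"
  by (simp add: nerve_def diagram_chain_def)

context category
begin

lemma path_comp_Cons:
  assumes "f \<in> Arr C"
  shows "path_comp C x (f # fs) = Comp C (path_comp C (Cod C f) fs) f"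
  using assms by (cases fs) (auto simp: Comp_Ident_left hom_def)

lemma path_comp_in_hom:
  "chain C x fs \<Longrightarrow> path_comp C x fs \<in> hom C x (vertex C (x, fs) (length fs))"
proof (induction fs arbitrary: x)
  case (Cons f fs)
  then have "path_comp C (Cod C f) fs \<in> hom C (Cod C f) (vertex C (x, f # fs) (length (f # fs)))"
    by (cases fs) fastforce+
  moreover have "f \<in> hom C x (Cod C f)"
    using Cons.prems by (auto simp: hom_def)
  ultimately show ?case
    using Cons.prems by (auto simp: path_comp_Cons simp del: path_comp.simps(2,3) vertex.simps intro: Comp_in_hom)
qed (auto simp: Ident_in_hom)

lemma diagram_path_comp:
  assumes "diagram C n v e" "i \<le> j" "j \<le> n"
  shows "path_comp C (v i) (map (\<lambda>k. e k (Suc k)) [i..<j]) = e i j"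
  using assms(2,3)
proof (induction i rule: inc_induct)
  case base
  then show ?case using assms(1) by (simp add: diagram_def)
next
  case (step k)
  have e: "e k (Suc k) \<in> hom C (v k) (v (Suc k))"
    using assms(1) step by (simp add: diagram_def)
  moreover have "Comp C (e (Suc k) j) (e k (Suc k)) = e k j"
    using assms(1) step unfolding diagram_def by (metis Suc_leI le_SucI order_refl)
  ultimately show ?case
    using step by (auto simp: upt_conv_Cons path_comp_Cons hom_def simp del: path_comp.simps(2,3))
qed

lemma diagram_chain_vertex:
  assumes "diagram C n v e" "i \<le> n"
  shows "vertex C (diagram_chain n v e) i = v i"
proof (cases i)
  case (Suc j)
  then have "e j (Suc j) \<in> hom C (v j) (v (Suc j))"
    using assms by (simp add: diagram_def)
  then show ?thesis
    using Suc assms by (simp add: diagram_chain_def hom_def)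
qed (simp add: diagram_chain_def)

lemma diagram_chain_edge:
  assumes "diagram C n v e" "i \<le> j" "j \<le> n"
  shows "edge C (diagram_chain n v e) i j = e i j"
proof -
  have "take (j - i) (drop i (map (\<lambda>k. e k (Suc k)) [0..<n])) = map (\<lambda>k. e k (Suc k)) [i..<j]"
    using assms(2,3) by (simp add: take_map drop_map)
  then show ?thesis
    using assms diagram_path_comp[OF assms]
      diagram_chain_vertex[OF assms(1), of i] by (simp add: edge_def diagram_chain_def)
qed

lemma diagram_chain_simp:
  assumes "diagram C n v e"
  shows "diagram_chain n v e \<in> Simp (nerve C) n"
proof -
  have *: "e i (Suc i) \<in> hom C (v i) (v (Suc i))" if "i < n" for i
    using assms that by (simp add: diagram_def)
  have "chain C (v i) (map (\<lambda>k. e k (Suc k)) [i..<n])" if "i \<le> n" for i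
    using that
  proof (induction i rule: inc_induct)
    case base
    then show ?case using assms by (simp add: diagram_def)
  next
    case (step k)
    then show ?case using *[of k] by (simp add: upt_conv_Cons hom_def)
  qed
  from this[of 0] show ?thesis by (simp add: nerve_def diagram_chain_def)
qed

lemma simp_vertex_Obj:
  assumes "s \<in> Simp (nerve C) n" "i \<le> n"
  shows "vertex C s i \<in> Obj C"
proof -
  obtain x fs where s: "s = (x, fs)" "length fs = n" "chain C x fs"
    using assms by (auto simp: nerve_def)
  show ?thesis
  proof (cases i)
    case 0
    with s show ?thesis by (cases fs) (auto simp: Dom_in_Obj)
  next
    case (Suc j)
    with s assms chain_nth[of C x fs j] show ?thesis by (auto simp: Cod_in_Obj)
  qed
qed

text \<open>\<open>path_comp\<close> peels arrows off at the front, so typing and the composition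
  law both go by induction on the starting vertex, downwards from the end.\<close>

lemma simp_diagram:
  assumes "s \<in> Simp (nerve C) n"
  shows "diagram C n (vertex C s) (edge C s)"
proof -
  obtain x fs where s: "s = (x, fs)" "length fs = n" "chain C x fs"
    using assms by (auto simp: nerve_def)
  have arr: "fs ! i \<in> hom C (vertex C s i) (vertex C s (Suc i))" if "i < n" for i
    using chain_nth[OF s(3)] s that by (simp add: hom_def)
  have rec: "edge C s i j = Comp C (edge C s (Suc i) j) (fs ! i)" if "i < j" "j \<le> n" for i j
  proof -
    have "take (j - i) (drop i fs) = fs ! i # take (j - Suc i) (drop (Suc i) fs)"
      using that s(2) by (simp add: Cons_nth_drop_Suc[symmetric] take_Cons' Suc_diff_Suc)
    then show ?thesis
      using arr[of i] that s by (simp add: edge_def path_comp_Cons hom_def del: path_comp.simps(2,3))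
  qed
  have hom: "edge C s i j \<in> hom C (vertex C s i) (vertex C s j)" if "i \<le> j" "j \<le> n" for i j
    using that
  proof (induction i rule: inc_induct)
    case base
    then show ?case using simp_vertex_Obj[OF assms] by (simp add: Ident_in_hom)
  next
    case (step k)
    then show ?case using rec[of k j] arr[of k] Comp_in_hom by simp
  qed
  have comp: "Comp C (edge C s j k) (edge C s i j) = edge C s i k" if "i \<le> j" "j \<le> k" "k \<le> n" for i j k
    using that(1)
  proof (induction i rule: inc_induct)
    case base
    then show ?case using Comp_Ident_right[OF hom] that by simp
  next
    case (step l)
    then have "l < n" using that by simp
    from step have "Comp C (edge C s j k) (edge C s l j) =
        Comp C (Comp C (edge C s j k) (edge C s (Suc l) j)) (fs ! l)"
      using rec[of l j] that Comp_assoc[OF arr[OF \<open>l < n\<close>] hom[of "Suc l" j] hom[of j k]]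
      by simp
    with step show ?case using rec[of l k] that by simp
  qed
  show ?thesis
    using hom comp simp_vertex_Obj[OF assms] by (simp add: diagram_def)
qed

lemma diagram_chain_of_simp:
  assumes "s \<in> Simp (nerve C) n"
  shows "diagram_chain n (vertex C s) (edge C s) = s"
  using assms edge_Suc[OF assms]
  by (cases s) (auto simp: diagram_chain_def nerve_def intro: nth_equalityI)

lemma simplicial_set_nerve: "simplicial_set (nerve C)"
proof -
  have d: "diagram C m (\<lambda>i. vertex C s (\<alpha> i)) (\<lambda>i j. edge C s (\<alpha> i) (\<alpha> j))"
    if "delta_map m n \<alpha>" "s \<in> Simp (nerve C) n" for m n \<alpha> s
    using diagram_reindex[OF simp_diagram] that by blast
  have 1: "act (nerve C) m n \<alpha> s \<in> Simp (nerve C) m"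
    if "delta_map m n \<alpha>" "s \<in> Simp (nerve C) n" for m n \<alpha> s
    using diagram_chain_simp[OF d[OF that]] by (simp add: nerve_act)
  have 2: "act (nerve C) m n \<alpha> s = act (nerve C) m n \<beta> s"
    if "\<And>t. t \<le> m \<Longrightarrow> \<alpha> t = \<beta> t" for m n \<alpha> \<beta> s
    using that by (auto simp: nerve_act intro: diagram_chain_cong)
  have 3: "act (nerve C) n n id s = s" if "s \<in> Simp (nerve C) n" for n s
    using diagram_chain_of_simp[OF that] by (simp add: nerve_act)
  have 4: "act (nerve C) l n (\<alpha> \<circ> \<beta>) s = act (nerve C) l m \<beta> (act (nerve C) m n \<alpha> s)"
    if "delta_map l m \<beta>" "delta_map m n \<alpha>" "s \<in> Simp (nerve C) n" for l m n \<alpha> \<beta> s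
    using that unfolding nerve_act
    by (intro diagram_chain_cong)
      (simp_all add: diagram_chain_vertex[OF d] diagram_chain_edge[OF d] delta_map_le delta_map_mono)
  show ?thesis
    unfolding simplicial_set_def using 1 2 3 4 by blast
qed

end

section \<open>Opposites and edgewise subdivision\<close>

context
  fixes X :: "'x sset"
  assumes X: "simplicial_set X"
begin

lemma act_simp: "delta_map m n \<alpha> \<Longrightarrow> s \<in> Simp X n \<Longrightarrow> act X m n \<alpha> s \<in> Simp X m"
  using X unfolding simplicial_set_def by blast

lemma act_cong:
  "delta_map m n \<alpha> \<Longrightarrow> s \<in> Simp X n \<Longrightarrow> (\<And>t. t \<le> m \<Longrightarrow> \<alpha> t = \<beta> t) \<Longrightarrow> act X m n \<alpha> s = act X m n \<beta> s"
  using X by (simp add: simplicial_set_def)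

lemma act_id: "s \<in> Simp X n \<Longrightarrow> act X n n id s = s"
  using X by (simp add: simplicial_set_def)

lemma act_ident: "s \<in> Simp X n \<Longrightarrow> (\<And>t. t \<le> n \<Longrightarrow> \<alpha> t = t) \<Longrightarrow> act X n n \<alpha> s = s"
  using act_cong[of n n id s \<alpha>] act_id by (simp add: delta_map_id)

lemma act_act:
  "delta_map l m \<beta> \<Longrightarrow> delta_map m n \<alpha> \<Longrightarrow> s \<in> Simp X n \<Longrightarrow>
     act X l m \<beta> (act X m n \<alpha> s) = act X l n (\<alpha> \<circ> \<beta>) s"
  using X by (simp add: simplicial_set_def)

text \<open>Both constructions precompose with an endofunctor of the simplex category.\<close>

lemma simplicial_set_reindex:
  fixes k :: "nat \<Rightarrow> nat" and R :: "nat \<Rightarrow> nat \<Rightarrow> (nat \<Rightarrow> nat) \<Rightarrow> nat \<Rightarrow> nat"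
  assumes delta: "\<And>m n \<alpha>. delta_map m n \<alpha> \<Longrightarrow> delta_map (k m) (k n) (R m n \<alpha>)"
    and cong: "\<And>m n \<alpha> \<beta> t. (\<And>t. t \<le> m \<Longrightarrow> \<alpha> t = \<beta> t) \<Longrightarrow> t \<le> k m \<Longrightarrow> R m n \<alpha> t = R m n \<beta> t"
    and id: "\<And>n t. t \<le> k n \<Longrightarrow> R n n id t = t"
    and comp: "\<And>l m n \<alpha> \<beta> t. delta_map l m \<beta> \<Longrightarrow> delta_map m n \<alpha> \<Longrightarrow> t \<le> k l \<Longrightarrow>
        R l n (\<alpha> \<circ> \<beta>) t = R m n \<alpha> (R l m \<beta> t)"
  shows "simplicial_set \<lparr>Simp = \<lambda>n. Simp X (k n), act = \<lambda>m n \<alpha>. act X (k m) (k n) (R m n \<alpha>)\<rparr>"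
proof -
  have comp': "act X (k l) (k n) (R l n (\<alpha> \<circ> \<beta>)) s = act X (k l) (k m) (R l m \<beta>) (act X (k m) (k n) (R m n \<alpha>) s)"
    if "delta_map l m \<beta>" "delta_map m n \<alpha>" "s \<in> Simp X (k n)" for l m n \<alpha> \<beta> s
  proof -
    have "act X (k l) (k n) (R l n (\<alpha> \<circ> \<beta>)) s = act X (k l) (k n) (R m n \<alpha> \<circ> R l m \<beta>) s"
      using that comp by (intro act_cong delta) (auto intro: delta_map_comp)
    then show ?thesis using that delta by (simp add: act_act)
  qed
  have cong': "act X (k m) (k n) (R m n \<alpha>) s = act X (k m) (k n) (R m n \<beta>) s"
    if "delta_map m n \<alpha>" "\<forall>t\<le>m. \<alpha> t = \<beta> t" "s \<in> Simp X (k n)" for m n \<alpha> \<beta> s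
    using that by (intro act_cong delta cong) auto
  have simp: "act X (k m) (k n) (R m n \<alpha>) s \<in> Simp X (k m)"
    if "delta_map m n \<alpha>" "s \<in> Simp X (k n)" for m n \<alpha> s
    using that by (intro act_simp delta)
  have id': "act X (k n) (k n) (R n n id) s = s" if "s \<in> Simp X (k n)" for n s
    using that id by (rule act_ident)
  show ?thesis
    unfolding simplicial_set_def sset.simps
    by (intro conjI allI impI ballI subsetI; (elim imageE)?)
      (simp only: simp, erule (2) cong', erule id', erule (2) comp')
qed

end

lemma simplicial_set_op:
  assumes "simplicial_set X"
  shows "simplicial_set (op_sset X)"
proof -
  have "simplicial_set \<lparr>Simp = \<lambda>n. Simp X n, act = \<lambda>m n \<alpha>. act X m n (\<lambda>t. n - \<alpha> (m - t))\<rparr>"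
  proof (rule simplicial_set_reindex[OF assms, where k = "\<lambda>n. n" and R = "\<lambda>m n \<alpha> t. n - \<alpha> (m - t)"])
    show "delta_map m n (\<lambda>t. n - \<alpha> (m - t))" if "delta_map m n \<alpha>" for m n \<alpha>
      using that by (intro delta_mapI) (simp_all add: delta_map_mono diff_le_mono2)
    \<comment> \<open>Reversal is an involution only on values up to \<open>m\<close>: truncated
      subtraction gives \<open>m - (m - b) = b\<close> because \<beta> is bounded by
      \<open>m\<close>.\<close>
    show "n - (\<alpha> \<circ> \<beta>) (l - t) = n - \<alpha> (m - (m - \<beta> (l - t)))"
      if "delta_map l m \<beta>" for l m n t and \<alpha> \<beta> :: "nat \<Rightarrow> nat"
      using delta_map_le[OF that, of "l - t"] by simp
  qed simp_all
  then show ?thesis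
    by (simp add: op_sset_def)
qed

lemma delta_map_Qmap:
  assumes \<alpha>: "delta_map m n \<alpha>"
  shows "delta_map (2 * m + 1) (2 * n + 1) (Qmap m n \<alpha>)"
proof (rule delta_mapI)
  fix i j assume ij: "i \<le> j" "j \<le> 2 * m + 1"
  \<comment> \<open>The points up to \<open>m\<close> form the reversed copy of [m], the later ones
    the straight copy. Monotonicity is checked inside each copy and across the boundary.\<close>
  consider "j \<le> m" | "i \<le> m" "m < j" | "m < i" by linarith
  then show "Qmap m n \<alpha> i \<le> Qmap m n \<alpha> j"
  proof cases
    case 1
    then show ?thesis
      using ij by (simp add: Qmap_def diff_le_mono2 delta_map_mono[OF \<alpha>])
  next
    case 2
    then show ?thesis
      using delta_map_le[OF \<alpha>, of "m - i"] by (simp add: Qmap_def)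
  next
    case 3
    then show ?thesis
      using ij by (simp add: Qmap_def delta_map_mono[OF \<alpha>])
  qed
next
  show "Qmap m n \<alpha> (2 * m + 1) \<le> 2 * n + 1"
    using delta_map_le[OF \<alpha>, of m] by (simp add: Qmap_def)
qed

lemma simplicial_set_sd:
  assumes "simplicial_set X"
  shows "simplicial_set (sd X)"
  unfolding sd_def
proof (rule simplicial_set_reindex[OF assms])
  show "Qmap l n (\<alpha> \<circ> \<beta>) t = Qmap m n \<alpha> (Qmap l m \<beta> t)"
    if "delta_map l m \<beta>" "t \<le> 2 * l + 1" for l m n t and \<alpha> \<beta> :: "nat \<Rightarrow> nat"
    using delta_map_le[OF that(1), of "l - t"] that(2) by (auto simp: Qmap_def)
  show "Qmap m n \<alpha> t = Qmap m n \<beta> t"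
    if "\<And>t. t \<le> m \<Longrightarrow> \<alpha> t = \<beta> t" "t \<le> 2 * m + 1" for m n t and \<alpha> \<beta> :: "nat \<Rightarrow> nat"
    using that(1)[of "m - t"] that(1)[of "t - m - 1"] that(2) by (simp add: Qmap_def)
qed (simp_all add: Qmap_def delta_map_Qmap del: One_nat_def)

section \<open>Segal simplicial sets are nerves\<close>

lemma delta_vertex: "i \<le> n \<Longrightarrow> delta_map 0 n (\<lambda>_. i)"
  by (rule delta_mapI) auto

lemma delta_edge: "i \<le> j \<Longrightarrow> j \<le> n \<Longrightarrow> delta_map 1 n (\<lambda>t. if t = 0 then i else j)"
  by (rule delta_mapI) auto

lemma delta_Suc: "delta_map n (Suc n) Suc"
  by (rule delta_mapI) auto

definition svertex :: "'x sset \<Rightarrow> nat \<Rightarrow> nat \<Rightarrow> 'x \<Rightarrow> 'x" where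
  "svertex Y n i = act Y 0 n (\<lambda>_. i)"

definition sedge :: "'x sset \<Rightarrow> nat \<Rightarrow> nat \<Rightarrow> nat \<Rightarrow> 'x \<Rightarrow> 'x" where
  "sedge Y n i j = act Y 1 n (\<lambda>t. if t = 0 then i else j)"

text \<open>The strict Segal condition, unrolled one edge at a time: Y_{n+1} is the fiber product of
  Y_1 and Y_n over Y_0. This splits a simplex the way a list splits into head and tail.\<close>

definition segal :: "'x sset \<Rightarrow> bool" where
  "segal Y \<longleftrightarrow> (\<forall>n. bij_betw (\<lambda>s. (sedge Y (Suc n) 0 1 s, act Y n (Suc n) Suc s)) (Simp Y (Suc n))
     {(e, s). e \<in> Simp Y 1 \<and> s \<in> Simp Y n \<and> svertex Y 1 1 e = svertex Y n 0 s})"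

text \<open>The objects are relabelled along a bijection \<open>ob\<close> from \<open>A\<close> to the $0$-simplices.\<close>

definition segal_cat :: "'x sset \<Rightarrow> 'o set \<Rightarrow> ('o \<Rightarrow> 'x) \<Rightarrow> ('o, 'x) cat" where
  "segal_cat Y A ob = \<lparr>Obj = A, Arr = Simp Y 1,
     Dom = \<lambda>m. the_inv_into A ob (svertex Y 1 0 m),
     Cod = \<lambda>m. the_inv_into A ob (svertex Y 1 1 m),
     Ident = \<lambda>x. sedge Y 0 0 0 (ob x),
     Comp = \<lambda>f g. sedge Y 2 0 2 (THE s. s \<in> Simp Y 2 \<and> sedge Y 2 0 1 s = g \<and> sedge Y 2 1 2 s = f)\<rparr>"

declare One_nat_def [simp del] One_nat_def [symmetric, simp]

locale segal_sset =
  fixes Y :: "'x sset" and A :: "'o set" and ob :: "'o \<Rightarrow> 'x"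
  assumes simplicial: "simplicial_set Y"
    and segal: "segal Y"
    and ob: "bij_betw ob A (Simp Y 0)"
begin

abbreviation "D \<equiv> segal_cat Y A ob"
abbreviation "lab \<equiv> the_inv_into A ob"

lemma lab_in: "v \<in> Simp Y 0 \<Longrightarrow> lab v \<in> A"
  using ob by (meson bij_betw_def bij_betw_the_inv_into bij_betwE)

lemma ob_lab: "v \<in> Simp Y 0 \<Longrightarrow> ob (lab v) = v"
  using ob by (auto simp: bij_betw_def intro: f_the_inv_into_f)

lemma lab_ob: "x \<in> A \<Longrightarrow> lab (ob x) = x"
  using ob by (auto simp: bij_betw_def intro: the_inv_into_f_f)

lemma ob_in: "x \<in> A \<Longrightarrow> ob x \<in> Simp Y 0"
  using ob by (auto simp: bij_betw_def)

lemma lab_inj: "v \<in> Simp Y 0 \<Longrightarrow> w \<in> Simp Y 0 \<Longrightarrow> lab v = lab w \<Longrightarrow> v = w"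
  using ob_lab by metis

lemma svertex_in: "s \<in> Simp Y n \<Longrightarrow> i \<le> n \<Longrightarrow> svertex Y n i s \<in> Simp Y 0"
  using simplicial by (simp add: svertex_def act_simp delta_vertex)

lemma sedge_in: "s \<in> Simp Y n \<Longrightarrow> i \<le> j \<Longrightarrow> j \<le> n \<Longrightarrow> sedge Y n i j s \<in> Simp Y 1"
  using simplicial act_simp[OF _ delta_edge] by (simp add: sedge_def)

lemma svertex_act:
  "delta_map m n \<alpha> \<Longrightarrow> s \<in> Simp Y n \<Longrightarrow> i \<le> m \<Longrightarrow>
     svertex Y m i (act Y m n \<alpha> s) = svertex Y n (\<alpha> i) s"
  using simplicial by (simp add: svertex_def act_act delta_vertex comp_def)

lemma sedge_act:
  assumes "delta_map m n \<alpha>" "s \<in> Simp Y n" "i \<le> j" "j \<le> m"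
  shows "sedge Y m i j (act Y m n \<alpha> s) = sedge Y n (\<alpha> i) (\<alpha> j) s"
  unfolding sedge_def act_act[OF simplicial delta_edge[OF assms(3,4)] assms(1,2)]
  by (rule arg_cong[where f = "\<lambda>\<alpha>. act Y 1 n \<alpha> s"]) auto

lemma svertex_sedge:
  assumes "s \<in> Simp Y n" "i \<le> j" "j \<le> n"
  shows "svertex Y 1 0 (sedge Y n i j s) = svertex Y n i s"
    and "svertex Y 1 1 (sedge Y n i j s) = svertex Y n j s"
  using svertex_act[OF delta_edge[OF assms(2,3)] assms(1)] unfolding sedge_def by auto

lemma svertex_0 [simp]: "v \<in> Simp Y 0 \<Longrightarrow> svertex Y 0 0 v = v"
  using act_ident[OF simplicial, of v 0 "\<lambda>_. 0"] by (simp add: svertex_def)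

lemma sedge_1 [simp]: "e \<in> Simp Y 1 \<Longrightarrow> sedge Y 1 0 1 e = e"
  using act_ident[OF simplicial, of e 1 "\<lambda>t. if t = 0 then 0 else 1"] by (simp add: sedge_def)

lemma sedge_refl: "s \<in> Simp Y n \<Longrightarrow> i \<le> n \<Longrightarrow> sedge Y n i i s = Ident D (lab (svertex Y n i s))"
  using sedge_act[OF delta_vertex, of i n s 0 0] svertex_in[of s n i]
  by (simp add: segal_cat_def ob_lab svertex_def)

lemma act_Suc: "s \<in> Simp Y (Suc n) \<Longrightarrow> act Y n (Suc n) Suc s \<in> Simp Y n"
  using simplicial delta_Suc by (rule act_simp)

lemma segal_unique:
  assumes "s \<in> Simp Y (Suc n)" "s' \<in> Simp Y (Suc n)" "sedge Y (Suc n) 0 1 s = sedge Y (Suc n) 0 1 s'"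
    "act Y n (Suc n) Suc s = act Y n (Suc n) Suc s'"
  shows "s = s'"
proof -
  have "inj_on (\<lambda>s. (sedge Y (Suc n) 0 1 s, act Y n (Suc n) Suc s)) (Simp Y (Suc n))"
    using segal by (simp only: segal_def bij_betw_def)
  then show ?thesis
    by (rule inj_onD) (use assms in auto)
qed

lemma segal_fill:
  assumes "e \<in> Simp Y 1" "s \<in> Simp Y n" "svertex Y 1 1 e = svertex Y n 0 s"
  obtains y where "y \<in> Simp Y (Suc n)" "sedge Y (Suc n) 0 1 y = e" "act Y n (Suc n) Suc y = s"
proof -
  have "(e, s) \<in> (\<lambda>s. (sedge Y (Suc n) 0 1 s, act Y n (Suc n) Suc s)) ` Simp Y (Suc n)"
    using segal assms by (simp only: segal_def bij_betw_def) auto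
  then show ?thesis using that by auto
qed

text \<open>For n = 1 the tail in the Segal condition is itself an edge, so a 2-simplex is
  determined by its edges 0-1 and 1-2, as \<open>Comp\<close> requires.\<close>

lemma sedge_12:
  assumes "s \<in> Simp Y 2" shows "act Y 1 2 Suc s = sedge Y 2 1 2 s"
proof -
  have "sedge Y 1 0 1 (act Y 1 2 Suc s) = sedge Y 2 1 2 s"
    using sedge_act[OF delta_Suc[of 1], of s 0 1] assms by simp
  then show ?thesis
    using act_Suc[of s 1] assms by simp
qed

text \<open>Restriction along the map [2] -> [n] with values i, j, k yields the 2-simplex that
  \<open>Comp\<close> asks for. The inequalities are weak on purpose: repeated vertices give the
  unit laws.\<close>

lemma Comp_sedge:
  assumes "y \<in> Simp Y n" "i \<le> j" "j \<le> k" "k \<le> n"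
  shows "Comp D (sedge Y n j k y) (sedge Y n i j y) = sedge Y n i k y"
proof -
  define \<alpha> :: "nat \<Rightarrow> nat" where "\<alpha> = (\<lambda>t. if t = 0 then i else if t = 1 then j else k)"
  define s where "s = act Y 2 n \<alpha> y"
  have \<alpha>: "delta_map 2 n \<alpha>"
    by (rule delta_mapI) (use assms in \<open>auto simp: \<alpha>_def\<close>)
  have s: "s \<in> Simp Y 2"
    unfolding s_def using simplicial \<alpha> assms(1) by (rule act_simp)
  have e: "sedge Y 2 0 1 s = sedge Y n i j y" "sedge Y 2 1 2 s = sedge Y n j k y"
      "sedge Y 2 0 2 s = sedge Y n i k y"
    using sedge_act[OF \<alpha> assms(1), of 0 1] sedge_act[OF \<alpha> assms(1), of 1 2]
      sedge_act[OF \<alpha> assms(1), of 0 2] by (simp_all add: s_def) (simp_all add: \<alpha>_def)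
  have "(THE s. s \<in> Simp Y 2 \<and> sedge Y 2 0 1 s = sedge Y n i j y \<and> sedge Y 2 1 2 s = sedge Y n j k y) = s"
  proof (rule the_equality)
    fix s' assume s': "s' \<in> Simp Y 2 \<and> sedge Y 2 0 1 s' = sedge Y n i j y \<and> sedge Y 2 1 2 s' = sedge Y n j k y"
    then show "s' = s"
      using segal_unique[of s' 1 s] s e sedge_12[of s] sedge_12[of s'] by simp
  qed (use s e in simp)
  then show ?thesis
    using e by (simp add: segal_cat_def)
qed

lemma hom_D: "e \<in> hom D x y \<longleftrightarrow> e \<in> Simp Y 1 \<and> lab (svertex Y 1 0 e) = x \<and> lab (svertex Y 1 1 e) = y"
  by (simp add: hom_def segal_cat_def)

lemma Obj_D: "Obj D = A"
  by (simp add: segal_cat_def)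

lemma fill_2:
  assumes "g \<in> hom D x y" "f \<in> hom D y z"
  obtains s where "s \<in> Simp Y 2" "sedge Y 2 0 1 s = g" "sedge Y 2 1 2 s = f"
proof -
  have "g \<in> Simp Y 1" "f \<in> Simp Y 1" "svertex Y 1 1 g = svertex Y 1 0 f"
    using assms by (auto simp: hom_D intro: lab_inj svertex_in)
  then show ?thesis
    using segal_fill[of g f 1] sedge_12 that by (metis Suc_1)
qed

lemma sedge_in_hom:
  "s \<in> Simp Y n \<Longrightarrow> i \<le> j \<Longrightarrow> j \<le> n \<Longrightarrow>
     sedge Y n i j s \<in> hom D (lab (svertex Y n i s)) (lab (svertex Y n j s))"
  by (simp add: hom_D sedge_in svertex_sedge)

lemma category_D: "category D"
proof
  show "Dom D f \<in> Obj D" "Cod D f \<in> Obj D" if "f \<in> Arr D" for f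
    using that svertex_in[of f 1] by (auto simp: segal_cat_def intro!: lab_in)
  show "Ident D x \<in> hom D x x" if "x \<in> Obj D" for x
    using that sedge_in_hom[of "ob x" 0 0 0] ob_in[of x] by (simp add: segal_cat_def lab_ob)
  show "Comp D f g \<in> hom D x z" if gf: "g \<in> hom D x y" "f \<in> hom D y z" for f g x y z
  proof -
    obtain s where "s \<in> Simp Y 2" "sedge Y 2 0 1 s = g" "sedge Y 2 1 2 s = f"
      using gf by (rule fill_2)
    then show ?thesis
      using gf Comp_sedge[of s 2 0 1 2] sedge_in_hom[of s 2 0 2] svertex_sedge[of s 2 0 1]
        svertex_sedge[of s 2 1 2] by (auto simp: hom_D)
  qed
  \<comment> \<open>The triples (0,1,1) and (0,0,1) of vertices of \<open>f\<close> itself.\<close>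
  show "Comp D (Ident D y) f = f" "Comp D f (Ident D x) = f" if "f \<in> hom D x y" for f x y
    using that Comp_sedge[of f 1 0 1 1] Comp_sedge[of f 1 0 0 1] sedge_refl[of f 1 0] sedge_refl[of f 1 1]
    by (auto simp: hom_D simp del: One_nat_def)
  show "Comp D (Comp D f g) h = Comp D f (Comp D g h)"
    if hgf: "h \<in> hom D w x" "g \<in> hom D x y" "f \<in> hom D y z" for f g h w x y z
  proof -
    obtain s where s: "s \<in> Simp Y 2" "sedge Y 2 0 1 s = g" "sedge Y 2 1 2 s = f"
      using hgf(2,3) by (rule fill_2)
    \<comment> \<open>The arrow \<open>h\<close> is glued onto the 2-simplex of \<open>g\<close> and
      \<open>f\<close>. Both bracketings are then the edge from 0 to 3 of the resulting
      3-simplex.\<close>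
    have "svertex Y 1 1 h = svertex Y 2 0 s"
      using hgf s svertex_sedge[of s 2 0 1] by (auto simp: hom_D intro!: lab_inj svertex_in)
    then obtain t where t: "t \<in> Simp Y (Suc 2)" "sedge Y (Suc 2) 0 1 t = h" "act Y 2 (Suc 2) Suc t = s"
      using segal_fill[of h s 2] s hgf by (auto simp: hom_D)
    have "sedge Y 3 1 2 t = g" "sedge Y 3 2 3 t = f"
      using sedge_act[OF delta_Suc[of 2] t(1), of 0 1] sedge_act[OF delta_Suc[of 2] t(1), of 1 2] s t(3)
      by simp_all
    then show ?thesis
      using t Comp_sedge[of t 3 0 1 2] Comp_sedge[of t 3 0 1 3] Comp_sedge[of t 3 1 2 3] Comp_sedge[of t 3 0 2 3]
      by simp
  qed
qed

section \<open>The spine map as an isomorphism onto the nerve\<close>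

definition spine :: "nat \<Rightarrow> 'x \<Rightarrow> 'o \<times> 'x list" where
  "spine n y = diagram_chain n (\<lambda>i. lab (svertex Y n i y)) (\<lambda>i j. sedge Y n i j y)"

lemma diagram_spine:
  "y \<in> Simp Y n \<Longrightarrow> diagram D n (\<lambda>i. lab (svertex Y n i y)) (\<lambda>i j. sedge Y n i j y)"
  by (simp add: diagram_def sedge_in_hom Comp_sedge sedge_refl lab_in svertex_in Obj_D)

lemma spine_Suc:
  assumes "y \<in> Simp Y (Suc n)"
  shows "spine (Suc n) y =
    (lab (svertex Y (Suc n) 0 y), sedge Y (Suc n) 0 1 y # snd (spine n (act Y n (Suc n) Suc y)))"
    and "fst (spine n (act Y n (Suc n) Suc y)) = Cod D (sedge Y (Suc n) 0 1 y)"
proof -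
  have "map (\<lambda>i. sedge Y (Suc n) i (Suc i) y) [1..<Suc n] =
      map (\<lambda>i. sedge Y n i (Suc i) (act Y n (Suc n) Suc y)) [0..<n]"
    by (rule nth_equalityI) (simp_all add: sedge_act[OF delta_Suc assms] plus_1_eq_Suc del: upt_Suc)
  then show "spine (Suc n) y =
      (lab (svertex Y (Suc n) 0 y), sedge Y (Suc n) 0 1 y # snd (spine n (act Y n (Suc n) Suc y)))"
    by (simp add: spine_def diagram_chain_def upt_conv_Cons del: upt_Suc)
  show "fst (spine n (act Y n (Suc n) Suc y)) = Cod D (sedge Y (Suc n) 0 1 y)"
    using svertex_sedge[OF assms, of 0 1]
    by (simp add: spine_def diagram_chain_def segal_cat_def svertex_act[OF delta_Suc assms])
qed

text \<open>By \<open>spine_Suc\<close>, splitting off the head of a list is the Segal map, so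
  injectivity and surjectivity pass from \<open>n\<close> to \<open>Suc n\<close>. In degree 0 both
  sides are the objects, matched by \<open>ob\<close>.\<close>

lemma bij_spine: "bij_betw (spine n) (Simp Y n) (Simp (nerve D) n)"
proof (rule bij_betwI')
  show "spine n s \<in> Simp (nerve D) n" if "s \<in> Simp Y n" for s
    unfolding spine_def using category.diagram_chain_simp[OF category_D diagram_spine[OF that]] .
  show "spine n s = spine n s' \<longleftrightarrow> s = s'" if "s \<in> Simp Y n" "s' \<in> Simp Y n" for s s'
  proof
    assume "spine n s = spine n s'"
    with that show "s = s'"
    proof (induction n arbitrary: s s')
      case 0
      then show ?case by (auto simp: spine_def diagram_chain_def intro: lab_inj)
    next
      case (Suc n)
      let ?t = "act Y n (Suc n) Suc s" and ?t' = "act Y n (Suc n) Suc s'"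
      have "sedge Y (Suc n) 0 1 s = sedge Y (Suc n) 0 1 s'" "spine n ?t = spine n ?t'"
        using Suc.prems spine_Suc[of s n] spine_Suc[of s' n] by (auto intro: prod_eqI)
      then show ?case
        using Suc.IH[of ?t ?t'] Suc.prems act_Suc segal_unique by blast
    qed
  qed simp
  show "\<exists>s\<in>Simp Y n. t = spine n s" if "t \<in> Simp (nerve D) n" for t
    using that
  proof (induction n arbitrary: t)
    case 0
    then obtain x where "t = (x, [])" "x \<in> A"
      by (auto simp: nerve_def segal_cat_def)
    then show ?case
      by (intro bexI[of _ "ob x"]) (auto simp: spine_def diagram_chain_def lab_ob ob_in)
  next
    case (Suc n)
    then obtain x e fs where t: "t = (x, e # fs)" "length fs = n" "e \<in> Arr D" "Dom D e = x"
        "chain D (Cod D e) fs"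
      by (auto simp: nerve_def length_Suc_conv)
    then obtain s where s: "s \<in> Simp Y n" "(Cod D e, fs) = spine n s"
      using Suc.IH[of "(Cod D e, fs)"] by (auto simp: nerve_def)
    have e: "e \<in> Simp Y 1" using t by (simp add: segal_cat_def)
    have "lab (svertex Y 1 1 e) = lab (svertex Y n 0 s)"
      using s(2) by (simp add: spine_def diagram_chain_def segal_cat_def)
    then have "svertex Y 1 1 e = svertex Y n 0 s"
      using e s by (intro lab_inj svertex_in) auto
    then obtain y where y: "y \<in> Simp Y (Suc n)" "sedge Y (Suc n) 0 1 y = e" "act Y n (Suc n) Suc y = s"
      using segal_fill e s(1) by blast
    have "x = lab (svertex Y (Suc n) 0 y)"
      using svertex_sedge(1)[OF y(1), of 0 1] y(2) t by (simp add: segal_cat_def)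
    then have "t = spine (Suc n) y"
      using spine_Suc(1)[OF y(1)] y t s(2) by (metis snd_conv)
    with y show ?case by blast
  qed
qed

lemma spine_act:
  assumes "delta_map m n \<alpha>" "y \<in> Simp Y n"
  shows "spine m (act Y m n \<alpha> y) = act (nerve D) m n \<alpha> (spine n y)"
  unfolding nerve_act spine_def[of m] using assms
  by (intro diagram_chain_cong)
    (simp_all add: spine_def category.diagram_chain_vertex[OF category_D diagram_spine]
      category.diagram_chain_edge[OF category_D diagram_spine] svertex_act sedge_act
      delta_map_le delta_map_mono)

definition unspine :: "nat \<Rightarrow> 'o \<times> 'x list \<Rightarrow> 'x" where
  "unspine n = the_inv_into (Simp Y n) (spine n)"

lemma unspine_spine: "y \<in> Simp Y n \<Longrightarrow> unspine n (spine n y) = y"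
  unfolding unspine_def using bij_spine[of n] by (auto simp: bij_betw_def intro: the_inv_into_f_f)

lemma sset_iso_unspine: "sset_iso (nerve D) Y unspine"
  unfolding sset_iso_def
proof (intro conjI allI impI ballI)
  show "simplicial_set (nerve D)"
    using category.simplicial_set_nerve[OF category_D] .
  show "bij_betw (unspine n) (Simp (nerve D) n) (Simp Y n)" for n
    unfolding unspine_def using bij_betw_the_inv_into[OF bij_spine] .
  fix m n \<alpha> t assume \<alpha>: "delta_map m n \<alpha>" and "t \<in> Simp (nerve D) n"
  then obtain y where y: "y \<in> Simp Y n" "t = spine n y"
    using bij_spine[of n] by (auto simp: bij_betw_def)
  then show "unspine m (act (nerve D) m n \<alpha> t) = act Y m n \<alpha> (unspine n t)"
    using \<alpha> act_simp[OF simplicial \<alpha>] by (simp add: spine_act[symmetric] unspine_spine)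
qed (fact simplicial)

lemma unspine_object: "x \<in> A \<Longrightarrow> unspine 0 (x, []) = ob x"
  using unspine_spine[of "ob x" 0] by (simp add: spine_def diagram_chain_def lab_ob ob_in)

lemma unspine_arrow: "e \<in> Arr D \<Longrightarrow> unspine 1 (Dom D e, [e]) = e"
  using unspine_spine[of e 1] sedge_1[of e] by (simp add: spine_def diagram_chain_def segal_cat_def upt_conv_Cons)

end

declare One_nat_def [symmetric, simp del] One_nat_def [simp]

section \<open>The undecking is a simplicial set\<close>

text \<open>Axiom (U2) makes the formula below uniform: for \<open>\<alpha>\<close> preserving the top it returns the
  nerve operator, since all arrows to the last vertex of a simplex of the undecking are \<open>tau\<close>.\<close>

definition fiber_chain ::
    "('o, 'a) cat \<Rightarrow> ('a, 'a \<times> 'a, 'o, 'a) func \<Rightarrow> 'o \<times> 'a list \<Rightarrow> nat \<Rightarrow> (nat \<Rightarrow> nat) \<Rightarrow> 'o \<times> 'a list" where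
  "fiber_chain C \<Phi> s m \<alpha> = diagram_chain m (\<lambda>i. fobj \<Phi> (edge C s (\<alpha> i) (\<alpha> m)))
     (\<lambda>i j. farr \<Phi> (edge C s (\<alpha> i) (\<alpha> j), edge C s (\<alpha> j) (\<alpha> m)))"

lemma fiber_chain_cong:
  "(\<And>t. t \<le> m \<Longrightarrow> \<alpha> t = \<beta> t) \<Longrightarrow> fiber_chain C \<Phi> s m \<alpha> = fiber_chain C \<Phi> s m \<beta>"
  unfolding fiber_chain_def by (intro diagram_chain_cong) simp_all

lemma Simp_undeck: "Simp (undeck C T \<Phi>) n = {s \<in> Simp (nerve C) n. vertex C s n \<in> T}"
  by (simp add: undeck_def)

context category
begin

lemma simp_edge_hom:
  "s \<in> Simp (nerve C) n \<Longrightarrow> i \<le> j \<Longrightarrow> j \<le> n \<Longrightarrow> edge C s i j \<in> hom C (vertex C s i) (vertex C s j)"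
  using simp_diagram by (simp add: diagram_def)

end

context unary_operadic_category
begin

abbreviation "X \<equiv> undeck C T \<Phi>"

section \<open>Chosen local terminal objects and the fiber functor\<close>

lemma connected_hom: "f \<in> hom C x y \<Longrightarrow> connected_in C x y"
  unfolding connected_in_def by (rule r_into_equivclp) auto

text \<open>Both codomains lie in the connected component of the common domain, which contains only
  one element of \<open>T\<close>; terminality then identifies the arrows.\<close>

lemma to_chosen_unique:
  assumes "f \<in> Arr C" "g \<in> Arr C" "Dom C f = Dom C g" "Cod C f \<in> T" "Cod C g \<in> T"
  shows "f = g"
proof -
  have f: "f \<in> hom C (Dom C f) (Cod C f)" and g: "g \<in> hom C (Dom C f) (Cod C g)"
    using assms by (auto simp: hom_def)
  have "Dom C f \<in> Obj C" using assms Dom_in_Obj by simp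
  then have "Cod C f = Cod C g"
    using chosen connected_hom[OF f] connected_hom[OF g] assms
    unfolding chosen_local_terminals_def by blast
  then show ?thesis
    using chosen connected_hom[OF f] f g assms \<open>Dom C f \<in> Obj C\<close>
    unfolding chosen_local_terminals_def by metis
qed

lemma tau_eq:
  assumes "f \<in> hom C x y" "y \<in> T"
  shows "f = tau C T x"
  unfolding tau_def
  by (rule the_equality[symmetric]) (use assms to_chosen_unique in \<open>auto simp: hom_def\<close>)

lemma tau_hom:
  assumes "x \<in> Obj C"
  obtains u where "u \<in> T" "tau C T x \<in> hom C x u"
proof -
  obtain u f where "u \<in> T" "f \<in> hom C x u"
    using chosen assms unfolding chosen_local_terminals_def by metis
  with tau_eq that show ?thesis by metis
qed

lemma fiber_Obj: "f \<in> Arr C \<Longrightarrow> fobj \<Phi> f \<in> Obj C"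
  using fiber_functor by (simp add: is_functor_def dec_def)

lemma fiber_hom:
  "\<lbrakk>g \<in> hom C b c; f \<in> hom C c x\<rbrakk> \<Longrightarrow> farr \<Phi> (g, f) \<in> hom C (fobj \<Phi> (Comp C f g)) (fobj \<Phi> f)"
  using fiber_functor by (auto simp: is_functor_def dec_def hom_def)

lemma fiber_Ident: "f \<in> hom C b c \<Longrightarrow> farr \<Phi> (Ident C b, f) = Ident C (fobj \<Phi> f)"
  using fiber_functor by (auto simp: is_functor_def dec_def hom_def)

lemma fiber_Comp:
  assumes "h \<in> hom C a b" "g \<in> hom C b c" "f \<in> hom C c x"
  shows "farr \<Phi> (Comp C g h, f) = Comp C (farr \<Phi> (g, f)) (farr \<Phi> (h, Comp C f g))"
proof -
  have "(g, f) \<in> Arr (dec C)" "(h, Comp C f g) \<in> Arr (dec C)"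
      "Cod (dec C) (h, Comp C f g) = Dom (dec C) (g, f)"
    using assms Comp_in_hom[of g b c f x] by (auto simp: dec_def hom_def)
  then have "farr \<Phi> (Comp (dec C) (g, f) (h, Comp C f g)) =
      Comp C (farr \<Phi> (g, f)) (farr \<Phi> (h, Comp C f g))"
    using fiber_functor unfolding is_functor_def by blast
  then show ?thesis by (simp add: dec_def)
qed

text \<open>Restricted along \<alpha>, the chain lies over its last vertex \<alpha>(m), so it is a
  functor from [m] to \<open>dec C\<close>, which \<Phi> carries to \<open>C\<close>.\<close>

lemma fiber_diagram:
  assumes s: "s \<in> Simp (nerve C) n" and \<alpha>: "delta_map m n \<alpha>"
  shows "diagram C m (\<lambda>i. fobj \<Phi> (edge C s (\<alpha> i) (\<alpha> m)))
    (\<lambda>i j. farr \<Phi> (edge C s (\<alpha> i) (\<alpha> j), edge C s (\<alpha> j) (\<alpha> m)))"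
proof -
  let ?v = "\<lambda>i. vertex C s (\<alpha> i)" and ?e = "\<lambda>i j. edge C s (\<alpha> i) (\<alpha> j)"
  have d: "diagram C m ?v ?e"
    using diagram_reindex[OF simp_diagram[OF s] \<alpha>] .
  have hom: "?e i j \<in> hom C (?v i) (?v j)" if "i \<le> j" "j \<le> m" for i j
    using d that by (simp add: diagram_def)
  have comp: "Comp C (?e j k) (?e i j) = ?e i k" if "i \<le> j" "j \<le> k" "k \<le> m" for i j k
    using d that by (simp add: diagram_def)
  have refl: "?e i i = Ident C (?v i)" if "i \<le> m" for i by simp
  have "fobj \<Phi> (?e i m) \<in> Obj C" if "i \<le> m" for i
    using hom[OF that] by (simp add: fiber_Obj hom_def)
  moreover have "farr \<Phi> (?e i i, ?e i m) = Ident C (fobj \<Phi> (?e i m))" if "i \<le> m" for i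
    using fiber_Ident[OF hom[OF that]] by simp
  moreover have "farr \<Phi> (?e i j, ?e j m) \<in> hom C (fobj \<Phi> (?e i m)) (fobj \<Phi> (?e j m))"
    if "i \<le> j" "j \<le> m" for i j
    using fiber_hom[OF hom hom, of i j m] comp[of i j m] that by simp
  moreover have "Comp C (farr \<Phi> (?e j k, ?e k m)) (farr \<Phi> (?e i j, ?e j m)) = farr \<Phi> (?e i k, ?e k m)"
    if "i \<le> j" "j \<le> k" "k \<le> m" for i j k
    using fiber_Comp[OF hom hom hom, of i j k m] comp[of i j k] comp[of j k m] that by simp
  ultimately show ?thesis
    unfolding diagram_def by blast
qed

text \<open>The last vertex is the fiber of an identity, hence chosen by (U1). So the result lies in
  the undecking even if \<open>s\<close> is only a simplex of the nerve.\<close>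

lemma fiber_chain_in:
  assumes "s \<in> Simp (nerve C) n" "delta_map m n \<alpha>"
  shows "fiber_chain C \<Phi> s m \<alpha> \<in> Simp X m"
  unfolding Simp_undeck fiber_chain_def
  using diagram_chain_simp[OF fiber_diagram[OF assms]] diagram_chain_vertex[OF fiber_diagram[OF assms], of m]
    simp_vertex_Obj[OF assms(1) delta_map_le[OF assms(2)], of m] by (simp add: U1)

lemma fiber_chain_edge:
  assumes "s \<in> Simp (nerve C) n" "delta_map m n \<alpha>" "i \<le> j" "j \<le> m"
  shows "edge C (fiber_chain C \<Phi> s m \<alpha>) i j =
    farr \<Phi> (edge C s (\<alpha> i) (\<alpha> j), edge C s (\<alpha> j) (\<alpha> m))"
  unfolding fiber_chain_def using diagram_chain_edge[OF fiber_diagram[OF assms(1,2)] assms(3,4)] .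

lemma undeck_edge_top:
  assumes "s \<in> Simp X n" "i \<le> n"
  shows "edge C s i n = tau C T (vertex C s i)"
  using assms simp_edge_hom[of s n i n] by (auto simp: Simp_undeck intro: tau_eq)

lemma fiber_chain_top:
  assumes s: "s \<in> Simp X n" and \<alpha>: "delta_map m n \<alpha>" "\<alpha> m = n"
  shows "fiber_chain C \<Phi> s m \<alpha> = act (nerve C) m n \<alpha> s"
proof -
  have n: "s \<in> Simp (nerve C) n" using s by (simp add: Simp_undeck)
  have top: "edge C s (\<alpha> i) n = tau C T (vertex C s (\<alpha> i))" if "i \<le> m" for i
    using undeck_edge_top[OF s delta_map_le[OF \<alpha>(1) that]] .
  show ?thesis
    unfolding fiber_chain_def nerve_act \<alpha>(2)
  proof (rule diagram_chain_cong)
    show "fobj \<Phi> (edge C s (\<alpha> 0) n) = vertex C s (\<alpha> 0)"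
      using simp_vertex_Obj[OF n delta_map_le[OF \<alpha>(1)]] by (simp add: top U2_obj)
    show "farr \<Phi> (edge C s (\<alpha> i) (\<alpha> (Suc i)), edge C s (\<alpha> (Suc i)) n) = edge C s (\<alpha> i) (\<alpha> (Suc i))"
      if "i < m" for i
      using U2_arr[OF simp_edge_hom[OF n, of "\<alpha> i" "\<alpha> (Suc i)"]] that delta_map_le[OF \<alpha>(1)]
        delta_map_mono[OF \<alpha>(1)] by (simp add: top)
  qed
qed

lemma fiber_chain_id: "s \<in> Simp X n \<Longrightarrow> fiber_chain C \<Phi> s n id = s"
  using fiber_chain_top[of s n n id] act_id[OF simplicial_set_nerve] by (simp add: delta_map_id Simp_undeck)

text \<open>This is (U3) in simplicial form: fibers of fiber maps are fibers of the original arrows.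
  The composition law of the undecking rests on it.\<close>

lemma fiber_chain_fiber_chain:
  assumes s: "s \<in> Simp (nerve C) n" and \<alpha>: "delta_map m n \<alpha>" and \<beta>: "delta_map l m \<beta>"
  shows "fiber_chain C \<Phi> (fiber_chain C \<Phi> s m \<alpha>) l \<beta> = fiber_chain C \<Phi> s l (\<alpha> \<circ> \<beta>)"
proof -
  let ?e = "\<lambda>i j. edge C s (\<alpha> i) (\<alpha> j)"
  have d: "diagram C m (\<lambda>i. vertex C s (\<alpha> i)) ?e"
    using diagram_reindex[OF simp_diagram[OF s] \<alpha>] .
  have hom: "?e i j \<in> hom C (vertex C s (\<alpha> i)) (vertex C s (\<alpha> j))" if "i \<le> j" "j \<le> m" for i j
    using d that by (simp add: diagram_def)
  have comp: "Comp C (?e j k) (?e i j) = ?e i k" if "i \<le> j" "j \<le> k" "k \<le> m" for i j k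
    using d that by (simp add: diagram_def)
  have obj: "fobj \<Phi> (farr \<Phi> (?e i j, ?e j m)) = fobj \<Phi> (?e i j)" if "i \<le> j" "j \<le> m" for i j
    using U3_obj[OF hom hom, of i j m] that by simp
  have arr: "farr \<Phi> (farr \<Phi> (?e i j, ?e j m), farr \<Phi> (?e j k, ?e k m)) = farr \<Phi> (?e i j, ?e j k)"
    if "i \<le> j" "j \<le> k" "k \<le> m" for i j k
    using U3_arr[OF hom hom hom, of i j k m] comp[of j k m] that by simp
  show ?thesis
    unfolding fiber_chain_def[of _ _ _ l] using delta_map_le[OF \<beta>] delta_map_mono[OF \<beta>]
    by (intro diagram_chain_cong) (simp_all add: fiber_chain_edge[OF s \<alpha>] obj arr)
qed

lemma top_face_fiber_chain:
  assumes s: "s \<in> Simp (nerve C) (Suc k)"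
  shows "top_face C \<Phi> (Suc k) s = fiber_chain C \<Phi> s k id"
proof -
  \<comment> \<open>Dropping the last vertex and repeating the one before it sends
    \<open>Suc k\<close> to \<open>k\<close>, so the fibers that \<open>phi\<close> takes over the
    end are fibers over vertex \<open>k\<close>.\<close>
  define \<gamma> where "\<gamma> = coface (Suc k) \<circ> codeg k"
  have c: "delta_map k (Suc k) (coface (Suc k))" "delta_map (Suc k) k (codeg k)"
    by (auto intro!: delta_mapI simp: coface_def codeg_def)
  then have \<gamma>: "delta_map (Suc k) (Suc k) \<gamma>"
    unfolding \<gamma>_def by (intro delta_map_comp)
  have v: "\<gamma> (Suc k) = k" "\<And>i. i \<le> k \<Longrightarrow> \<gamma> i = i"
    by (auto simp: \<gamma>_def coface_def codeg_def)
  let ?s = "act (nerve C) (Suc k) (Suc k) \<gamma> s"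
  have "degen (nerve C) k k (face (nerve C) (Suc k) (Suc k) s) = ?s"
    using act_act[OF simplicial_set_nerve c(2,1) s] by (simp add: degen_def face_def \<gamma>_def)
  moreover have "edge C ?s i j = edge C s (\<gamma> i) (\<gamma> j)" if "i \<le> j" "j \<le> Suc k" for i j
    unfolding nerve_act using diagram_chain_edge[OF diagram_reindex[OF simp_diagram[OF s] \<gamma>] that] .
  ultimately show ?thesis
    by (simp add: top_face_def phi_def nerve_map_def chain_to_dec_def v fiber_chain_def diagram_chain_def)
qed

text \<open>Successive top faces take fibers of fibers, which collapse to fibers over vertex
  \<open>k\<close> of the original chain. For \<open>d = 0\<close> the formula holds by (U2),
  because \<open>s\<close> ends in \<open>T\<close>.\<close>

lemma top_faces_fiber_chain:
  "s \<in> Simp X (k + d) \<Longrightarrow> top_faces C \<Phi> k d s = fiber_chain C \<Phi> s k id"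
proof (induction d arbitrary: s)
  case (Suc d)
  then have s: "s \<in> Simp (nerve C) (Suc (k + d))" by (simp add: Simp_undeck)
  have "fiber_chain C \<Phi> s (k + d) id \<in> Simp X (k + d)"
    using fiber_chain_in[OF s delta_map_id] by simp
  from Suc.IH[OF this] show ?case
    using top_face_fiber_chain[OF s] fiber_chain_fiber_chain[OF s delta_map_id delta_map_id, of "k + d" k]
    by (simp only: top_faces.simps add_Suc_right id_comp le_add1 order_refl simp_thms)
qed (simp add: fiber_chain_id)

text \<open>Both stages of the definition, the iterated top faces and the top-preserving nerve
  operator, are instances of \<open>fiber_chain\<close>, and they compose to one formula for every
  \<alpha>.\<close>

lemma undeck_act:
  assumes s: "s \<in> Simp X n" and \<alpha>: "delta_map m n \<alpha>"
  shows "act X m n \<alpha> s = fiber_chain C \<Phi> s m \<alpha>"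
proof -
  have n: "s \<in> Simp (nerve C) n" using s by (simp add: Simp_undeck)
  have le: "\<alpha> m \<le> n" using delta_map_le[OF \<alpha>] by simp
  have id: "delta_map (\<alpha> m) n id" using le by (rule delta_map_id)
  have \<alpha>': "delta_map m (\<alpha> m) \<alpha>"
    by (rule delta_mapI) (use \<alpha> in \<open>auto intro: delta_map_mono\<close>)
  have "act X m n \<alpha> s = act (nerve C) m (\<alpha> m) \<alpha> (fiber_chain C \<Phi> s (\<alpha> m) id)"
    using s le by (simp add: undeck_def[of C T \<Phi>] top_faces_fiber_chain)
  also have "\<dots> = fiber_chain C \<Phi> (fiber_chain C \<Phi> s (\<alpha> m) id) m \<alpha>"
    using fiber_chain_top[OF fiber_chain_in[OF n id] \<alpha>' refl] by simp
  finally show ?thesis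
    using fiber_chain_fiber_chain[OF n id \<alpha>'] by simp
qed

lemma simplicial_set_undeck: "simplicial_set X"
proof -
  have n: "s \<in> Simp (nerve C) n" if "s \<in> Simp X n" for s n
    using that by (simp add: Simp_undeck)
  have comp: "act X l n (\<alpha> \<circ> \<beta>) s = act X l m \<beta> (act X m n \<alpha> s)"
    if "delta_map l m \<beta>" "delta_map m n \<alpha>" "s \<in> Simp X n" for l m n \<alpha> \<beta> s
    using that fiber_chain_in[OF n[OF that(3)] that(2)] delta_map_comp[OF that(1,2)]
    by (simp add: undeck_act fiber_chain_fiber_chain[OF n])
  have cong: "act X m n \<alpha> s = act X m n \<beta> s"
    if "delta_map m n \<alpha>" "\<forall>t\<le>m. \<alpha> t = \<beta> t" "s \<in> Simp X n" for m n \<alpha> \<beta> s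
  proof -
    have "delta_map m n \<beta>"
      using that(1,2) by (intro delta_mapI) (metis delta_map_mono le_trans, metis delta_map_le order_refl)
    then show ?thesis
      using that by (auto simp: undeck_act intro: fiber_chain_cong)
  qed
  have simp: "act X m n \<alpha> s \<in> Simp X m" if "delta_map m n \<alpha>" "s \<in> Simp X n" for m n \<alpha> s
    unfolding undeck_act[OF that(2,1)] using fiber_chain_in[OF n[OF that(2)] that(1)] .
  have id: "act X n n id s = s" if "s \<in> Simp X n" for n s
    using that by (simp add: undeck_act delta_map_id fiber_chain_id)
  show ?thesis
    unfolding simplicial_set_def
    by (intro conjI allI impI ballI subsetI; (elim imageE)?)
      (simp only: simp, erule (2) cong, erule id, erule (2) comp)
qed

end

section \<open>Lifting chains along the fiber functor\<close>

text \<open>The fibers over the end of a chain, leaving out the last fiber \<open>fobj \<Phi> (Ident C w)\<close>.\<close>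

primrec fibers :: "('o, 'a) cat \<Rightarrow> ('a, 'a \<times> 'a, 'o, 'a) func \<Rightarrow> 'a list \<Rightarrow> 'a list" where
  "fibers C \<Phi> [] = []"
| "fibers C \<Phi> (h # hs) = farr \<Phi> (h, path_comp C (Cod C h) hs) # fibers C \<Phi> hs"

lemma length_fibers [simp]: "length (fibers C \<Phi> hs) = length hs"
  by (induction hs) auto

text \<open>The recursive form suits lifting; the indexed form is what the zeroth face
  computes.\<close>

lemma fibers_conv_nth:
  "fibers C \<Phi> hs =
     map (\<lambda>i. farr \<Phi> (hs ! i, path_comp C (Cod C (hs ! i)) (drop (Suc i) hs))) [0..<length hs]"
proof (induction hs)
  case (Cons h hs)
  then show ?case
    by (simp add: map_Suc_upt[symmetric] upt_conv_Cons del: upt_Suc)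
qed simp

lemma (in category) chain_append:
  "chain C x (fs @ gs) \<longleftrightarrow> chain C x fs \<and> chain C (vertex C (x, fs) (length fs)) gs"
proof (induction fs arbitrary: x)
  case Nil
  show ?case by (cases gs) (auto intro: Dom_in_Obj)
next
  case (Cons f fs)
  then show ?case by (cases fs) auto
qed

locale blow_up_category = unary_operadic_category +
  assumes blow_up: "blow_up C \<Phi>"
begin

lemma lift:
  assumes "f \<in> Arr C" "p \<in> Arr C" "Dom C p = fobj \<Phi> f"
  shows "\<exists>!q. q \<in> Arr (dec C) \<and> Dom (dec C) q = f \<and> farr \<Phi> q = p"
  using blow_up assms unfolding blow_up_def discrete_opfibration_def by (simp add: dec_def)

lemma lift_exists:
  assumes "f \<in> Arr C" "p \<in> Arr C" "Dom C p = fobj \<Phi> f"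
  obtains k h where "k \<in> Arr C" "h \<in> Arr C" "Cod C k = Dom C h" "Comp C h k = f" "farr \<Phi> (k, h) = p"
  using lift[OF assms] that by (auto simp: dec_def)

lemma lift_unique:
  assumes "k \<in> hom C a b" "h \<in> hom C b c" "k' \<in> hom C a' b'" "h' \<in> hom C b' c'"
    "Comp C h k = Comp C h' k'" "farr \<Phi> (k, h) = farr \<Phi> (k', h')"
  shows "k = k' \<and> h = h'"
proof -
  have "Comp C h k \<in> Arr C" "farr \<Phi> (k, h) \<in> Arr C" "Dom C (farr \<Phi> (k, h)) = fobj \<Phi> (Comp C h k)"
    using Comp_in_hom[OF assms(1,2)] fiber_hom[OF assms(1,2)] by (auto simp: hom_def)
  note l = lift[OF this]
  have "(k, h) \<in> Arr (dec C)" "Dom (dec C) (k, h) = Comp C h k"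
      "(k', h') \<in> Arr (dec C)" "Dom (dec C) (k', h') = Comp C h k"
    using assms by (auto simp: dec_def hom_def)
  then have "(k, h) = (k', h')"
    using l assms(6) by (metis (no_types))
  then show ?thesis by simp
qed

text \<open>Both \<open>Ident C x \<circ> b\<close> and \<open>b \<circ> Ident C a\<close> factor \<open>b\<close>, with the same fiber map.\<close>

lemma Ident_if_fiber_in_T:
  assumes "b \<in> hom C a x" "fobj \<Phi> b \<in> T"
  shows "b = Ident C x"
proof -
  have ax: "a \<in> Obj C" "x \<in> Obj C"
    using assms(1) by (auto simp: hom_def Dom_in_Obj Cod_in_Obj)
  note id = Ident_in_hom[OF ax(1)] Ident_in_hom[OF ax(2)]
  have "farr \<Phi> (b, Ident C x) \<in> hom C (fobj \<Phi> b) (fobj \<Phi> (Ident C x))"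
    using fiber_hom[OF assms(1) id(2)] Comp_Ident_left[OF assms(1)] by simp
  then have "farr \<Phi> (b, Ident C x) = tau C T (fobj \<Phi> b)"
    by (rule tau_eq) (simp add: U1 ax)
  moreover have "farr \<Phi> (Ident C a, b) = tau C T (fobj \<Phi> b)"
    using fiber_Ident[OF assms(1)] Ident_in_hom[of "fobj \<Phi> b"] assms
    by (auto simp: hom_def fiber_Obj intro!: tau_eq)
  ultimately show ?thesis
    using lift_unique[OF assms(1) id(2) id(1) assms(1)] Comp_Ident_left[OF assms(1)]
      Comp_Ident_right[OF assms(1)] by simp
qed

text \<open>The first arrow and the remaining composite form a lift of the first entry of
  \<open>fibers\<close> that starts at the total composite. Uniqueness of lifts fixes both, and the
  remaining composite is the start of the next step.\<close>

lemma fibers_inj: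
  "chain C x hs \<Longrightarrow> chain C x hs' \<Longrightarrow> path_comp C x hs = path_comp C x hs' \<Longrightarrow>
     fibers C \<Phi> hs = fibers C \<Phi> hs' \<Longrightarrow> hs = hs'"
proof (induction hs arbitrary: x hs')
  case Nil
  then show ?case by (cases hs') auto
next
  case (Cons h hs)
  then obtain h' ks where hs': "hs' = h' # ks" by (cases hs') auto
  have hom: "h \<in> hom C x (Cod C h)" "h' \<in> hom C x (Cod C h')"
    using Cons.prems hs' by (auto simp: hom_def)
  note pc = path_comp_in_hom[of "Cod C h" hs] path_comp_in_hom[of "Cod C h'" ks]
  have "h = h' \<and> path_comp C (Cod C h) hs = path_comp C (Cod C h') ks"
    using Cons.prems hs' pc hom
    by (intro lift_unique[OF hom(1) pc(1) hom(2) pc(2)])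
      (auto simp: path_comp_Cons simp del: path_comp.simps(2,3))
  then show ?case
    using Cons hs' by auto
qed

text \<open>The induction varies \<open>b\<close>: each lift replaces it by its second factor
  \<open>h\<close>, whose fiber is where the rest of the chain begins.\<close>

lemma fibers_lift:
  assumes "b \<in> Arr C" "chain C (fobj \<Phi> b) ps" "vertex C (fobj \<Phi> b, ps) (length ps) \<in> T"
  shows "\<exists>hs. chain C (Dom C b) hs \<and> path_comp C (Dom C b) hs = b \<and> fibers C \<Phi> hs = ps"
  using assms
proof (induction ps arbitrary: b)
  case Nil
  then have "b = Ident C (Cod C b)"
    by (intro Ident_if_fiber_in_T) (auto simp: hom_def)
  \<comment> \<open>The empty chain composes to the identity of its start, so the source of
    \<open>b\<close> has to equal its target.\<close>
  moreover from this have "Dom C b = Cod C b"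
    using Ident_in_hom[of "Cod C b"] Cod_in_Obj[of b] Nil by (simp add: hom_def)
  ultimately show ?case
    using Nil by (intro exI[of _ "[]"]) (auto simp: Cod_in_Obj)
next
  case (Cons p ps)
  then have p: "p \<in> Arr C" "Dom C p = fobj \<Phi> b" "chain C (Cod C p) ps" by auto
  obtain k h where kh: "k \<in> Arr C" "h \<in> Arr C" "Cod C k = Dom C h" "Comp C h k = b" "farr \<Phi> (k, h) = p"
    using lift_exists[OF Cons.prems(1) p(1,2)] .
  then have hom: "k \<in> hom C (Dom C k) (Cod C k)" "h \<in> hom C (Cod C k) (Cod C h)"
    by (auto simp: hom_def)
  have cod: "Cod C p = fobj \<Phi> h" and dom: "Dom C b = Dom C k"
    using fiber_hom[OF hom] Comp_in_hom[OF hom] kh by (auto simp: hom_def)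
  have "vertex C (fobj \<Phi> h, ps) (length ps) \<in> T"
    using Cons.prems(3) cod by (cases ps) auto
  then obtain hs where "chain C (Dom C h) hs" "path_comp C (Dom C h) hs = h" "fibers C \<Phi> hs = ps"
    using Cons.IH[OF kh(2)] p(3) cod by auto
  then show ?case
    using kh dom by (intro exI[of _ "k # hs"])
      (simp add: path_comp_Cons del: path_comp.simps(2,3))
qed

end

section \<open>The expanded category\<close>

lemma Simp_expanded: "Simp (expanded C T \<Phi>) n = Simp (undeck C T \<Phi>) (2 * n + 1)"
  by (simp add: expanded_def op_sset_def sd_def)

context unary_operadic_category
begin

abbreviation "E \<equiv> expanded C T \<Phi>"

lemma Simp_E_nerve: "s \<in> Simp E n \<Longrightarrow> s \<in> Simp (nerve C) (2 * n + 1)"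
  by (simp add: Simp_expanded Simp_undeck)

text \<open>The opposite and the reversed half of \<open>Qmap\<close> cancel: on the first half the
  operator is \<alpha>, on the second its mirror image under t -> 2n+1-t. Only the values of
  \<gamma> up to 2m+1 are prescribed, so it may be \<open>Suc\<close> or indexing into a
  list.\<close>

lemma expanded_act:
  assumes s: "s \<in> Simp E n" and \<alpha>: "delta_map m n \<alpha>"
    and \<gamma>: "\<And>t. t \<le> m \<Longrightarrow> \<gamma> t = \<alpha> t" "\<And>t. t \<le> m \<Longrightarrow> \<gamma> (2 * m + 1 - t) = 2 * n + 1 - \<alpha> t"
  shows "act E m n \<alpha> s = fiber_chain C \<Phi> s (2 * m + 1) \<gamma>"
proof -
  let ?\<alpha> = "\<lambda>t. n - \<alpha> (m - t)"
  have le: "\<alpha> t \<le> n" if "t \<le> m" for t using delta_map_le[OF \<alpha> that] .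
  have "delta_map m n ?\<alpha>"
    by (intro delta_mapI) (simp_all add: delta_map_mono[OF \<alpha>] diff_le_mono2)
  then have "act E m n \<alpha> s = fiber_chain C \<Phi> s (2 * m + 1) (Qmap m n ?\<alpha>)"
    using undeck_act[OF _ delta_map_Qmap] s
    by (simp add: expanded_def op_sset_def sd_def)
  also have "\<dots> = fiber_chain C \<Phi> s (2 * m + 1) \<gamma>"
  proof (rule fiber_chain_cong)
    fix t assume t: "t \<le> 2 * m + 1"
    show "Qmap m n ?\<alpha> t = \<gamma> t"
    proof (cases "t \<le> m")
      case True
      then show ?thesis using le[OF True] \<gamma>(1)[OF True] by (simp add: Qmap_def)
    next
      case False
      define r where "r = 2 * m + 1 - t"
      have r: "r \<le> m" "t = 2 * m + 1 - r" "m - (t - m - 1) = r" using False t by (auto simp: r_def)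
      then show ?thesis using le[OF r(1)] \<gamma>(2)[OF r(1)] False by (simp add: Qmap_def)
    qed
  qed
  finally show ?thesis .
qed

lemma simplicial_set_expanded: "simplicial_set E"
  unfolding expanded_def by (intro simplicial_set_op simplicial_set_sd simplicial_set_undeck)

lemma E_vertex:
  assumes "s \<in> Simp E n" "i \<le> n"
  shows "svertex E n i s = fiber_chain C \<Phi> s 1 ((!) [i, 2 * n + 1 - i])"
  unfolding svertex_def
  using expanded_act[OF assms(1), of 0 "\<lambda>_. i" "(!) [i, 2 * n + 1 - i]"] assms(2)
  by (simp add: delta_map_def mono_on_def)

lemma E_edge:
  assumes "s \<in> Simp E n" "i \<le> j" "j \<le> n"
  shows "sedge E n i j s = fiber_chain C \<Phi> s 3 ((!) [i, j, 2 * n + 1 - j, 2 * n + 1 - i])"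
  unfolding sedge_def
proof -
  let ?\<gamma> = "(!) [i, j, 2 * n + 1 - j, 2 * n + 1 - i]"
  have "?\<gamma> t = (if t = 0 then i else j)" "?\<gamma> (2 * 1 + 1 - t) = 2 * n + 1 - (if t = 0 then i else j)"
    if "t \<le> 1" for t
    using that by (cases t; simp)+
  from expanded_act[OF assms(1) delta_edge[OF assms(2,3)] this]
  show "act E 1 n (\<lambda>t. if t = 0 then i else j) s = fiber_chain C \<Phi> s 3 ?\<gamma>"
    by (simp add: numeral_3_eq_3)
qed

lemma E_tail:
  assumes "s \<in> Simp E (Suc n)"
  shows "act E n (Suc n) Suc s = fiber_chain C \<Phi> s (2 * n + 1) Suc"
  by (rule expanded_act[OF assms]) (auto simp: delta_map_def mono_on_def)

text \<open>The only arrow of such a chain ends in \<open>T\<close>, so it is \<open>tau\<close> of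
  its source. This identifies 0-simplices with objects of \<open>C\<close>.\<close>

lemma Simp_X_1:
  assumes "v \<in> Simp X 1" shows "fst v \<in> Obj C" "v = ex_obj C T (fst v)"
  using assms by (auto simp: Simp_undeck nerve_def ex_obj_def length_Suc_conv One_nat_def Dom_in_Obj
      intro: tau_eq simp: hom_def)

lemma E_vertex_eq:
  assumes "s \<in> Simp E n" "i \<le> n"
  shows "svertex E n i s = ex_obj C T (fobj \<Phi> (edge C s i (2 * n + 1 - i)))"
proof -
  have "delta_map 1 (2 * n + 1) ((!) [i, 2 * n + 1 - i])"
    using assms(2) by (intro delta_mapI) (auto simp: le_Suc_eq)
  from fiber_chain_in[OF Simp_E_nerve[OF assms(1)] this] have "svertex E n i s \<in> Simp X 1"
    using E_vertex[OF assms] by simp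
  from Simp_X_1(2)[OF this] show ?thesis
    using E_vertex[OF assms] by (simp add: fiber_chain_def diagram_chain_def One_nat_def)
qed

lemma bij_ex_obj: "bij_betw (ex_obj C T) (Obj C) (Simp E 0)"
proof (rule bij_betwI')
  show "ex_obj C T x \<in> Simp E 0" if x: "x \<in> Obj C" for x
  proof -
    obtain u where "u \<in> T" "tau C T x \<in> hom C x u" using x by (rule tau_hom)
    then show ?thesis
      by (auto simp: Simp_expanded Simp_undeck nerve_def ex_obj_def hom_def Cod_in_Obj)
  qed
  show "\<exists>x\<in>Obj C. v = ex_obj C T x" if "v \<in> Simp E 0" for v
    using Simp_X_1[of v] that by (auto simp: Simp_expanded)
qed (auto simp: ex_obj_def)

text \<open>Vertex 0 pairs the two outermost vertices of the chain. The arrow between them is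
  \<open>tau\<close>, whose fiber is its source by (U2).\<close>

lemma source_vertex:
  assumes "s \<in> Simp E n"
  shows "svertex E n 0 s = ex_obj C T (fst s)"
proof -
  have s: "s \<in> Simp X (2 * n + 1)" using assms by (simp add: Simp_expanded)
  have "edge C s 0 (2 * n + 1) = tau C T (vertex C s 0)" "vertex C s 0 \<in> Obj C"
    using undeck_edge_top[OF s] simp_vertex_Obj[of s "2 * n + 1" 0] s by (auto simp: Simp_undeck)
  then show ?thesis
    using E_vertex_eq[OF assms, of 0] by (cases s) (simp add: U2_obj)
qed

text \<open>Vertex 1 pairs the vertices 1 and 2 of the chain, which \<open>b\<close> joins.\<close>

lemma target_vertex:
  assumes "(x, [a, b, t]) \<in> Simp E 1"
  shows "svertex E 1 1 (x, [a, b, t]) = ex_obj C T (fobj \<Phi> b)"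
  using E_vertex_eq[OF assms, of 1] edge_Suc[OF Simp_E_nerve[OF assms], of 1] by (simp add: numeral_2_eq_2)

text \<open>A simplex of degree \<open>Suc n\<close> has 2n+3 arrows. The outer two are split off
  because the zeroth face deletes both ends of the chain.\<close>

lemma simp_decomp:
  assumes "s \<in> Simp E (Suc n)"
  obtains x a hs t where "s = (x, a # hs @ [t])" "length hs = 2 * n + 1"
proof -
  obtain x a r where s: "s = (x, a # r)" "length r = Suc (2 * n + 1)"
    using Simp_E_nerve[OF assms] by (auto simp: nerve_def length_Suc_conv)
  then show ?thesis
    using that[of x a "butlast r" "last r"] by (cases r rule: rev_cases) auto
qed

section \<open>The first edge and the zeroth face of a simplex of the expanded category\<close>

context
  fixes x a hs t n s
  defines "s \<equiv> (x, a # hs @ [t])"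
  assumes s: "s \<in> Simp E (Suc n)" and len: "length hs = 2 * n + 1"
begin

lemma decomp_chain:
  shows "a \<in> hom C x (Cod C a)" "chain C (Cod C a) hs" "Cod C t \<in> T"
    "path_comp C (Cod C a) hs \<in> hom C (Cod C a) (Dom C t)" "t = tau C T (Dom C t)"
proof -
  have c: "chain C x (a # hs @ [t])" "Cod C t \<in> T"
    using s len by (auto simp: s_def Simp_expanded Simp_undeck nerve_def nth_append)
  then have t: "chain C (Cod C a) hs" "t \<in> Arr C" "Dom C t = vertex C (Cod C a, hs) (length hs)"
    by (auto simp: chain_append simp del: vertex.simps)
  with c show "a \<in> hom C x (Cod C a)" "chain C (Cod C a) hs" "Cod C t \<in> T"
      "path_comp C (Cod C a) hs \<in> hom C (Cod C a) (Dom C t)" "t = tau C T (Dom C t)"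
    using path_comp_in_hom[OF t(1)] tau_eq[of t "Dom C t" "Cod C t"] by (auto simp: hom_def)
qed

lemma decomp_edge:
  assumes "i \<le> 2 * n + 1"
  shows "edge C s (Suc i) (2 * n + 2) = path_comp C (vertex C s (Suc i)) (drop i hs)"
  using assms len by (simp add: edge_def s_def)

text \<open>The positions 0, 1, 2n+2, 2n+3 include the last vertex, so the operator preserves the
  top and is that of the nerve: no fibers are taken.\<close>

lemma decomp_first_edge:
  "sedge E (Suc n) 0 1 s = (x, [a, path_comp C (Cod C a) hs, t])"
proof -
  let ?\<gamma> = "(!) [0, 1, 2 * n + 2, 2 * n + 3]"
  have sX: "s \<in> Simp X (2 * n + 3)" using s by (simp add: Simp_expanded numeral_3_eq_3)
  then have sn: "s \<in> Simp (nerve C) (2 * n + 3)" by (simp add: Simp_undeck)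
  have "delta_map 3 (2 * n + 3) ?\<gamma>"
    by (rule delta_mapI) (auto simp: le_Suc_eq numeral_3_eq_3 numeral_2_eq_2)
  then have "sedge E (Suc n) 0 1 s = act (nerve C) 3 (2 * n + 3) ?\<gamma> s"
    using E_edge[OF s, of 0 1] fiber_chain_top[OF sX] by (simp add: numeral_3_eq_3)
  also have "\<dots> = (x, [edge C s 0 1, edge C s 1 (2 * n + 2), edge C s (2 * n + 2) (2 * n + 3)])"
    by (simp add: nerve_act diagram_chain_def s_def numeral_3_eq_3)
  also have "edge C s 0 1 = a"
    using edge_Suc[OF sn, of 0] by (simp add: s_def)
  also have "edge C s (2 * n + 2) (2 * n + 3) = t"
    using edge_Suc[OF sn, of "2 * n + 2"] len by (simp add: s_def numeral_3_eq_3 nth_append)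
  also have "edge C s 1 (2 * n + 2) = path_comp C (Cod C a) hs"
    using decomp_edge[of 0] by (simp add: s_def)
  finally show ?thesis .
qed

text \<open>The operator \<open>Suc\<close> stops at vertex 2n+2, the source of \<open>t\<close>.
  The top is lost, and fibers are taken over that vertex.\<close>

lemma decomp_tail:
  "act E n (Suc n) Suc s = (fobj \<Phi> (path_comp C (Cod C a) hs), fibers C \<Phi> hs)"
proof -
  have sn: "s \<in> Simp (nerve C) (2 * n + 3)" using Simp_E_nerve[OF s] by (simp add: numeral_3_eq_3)
  have "edge C s (Suc i) (Suc (Suc i)) = hs ! i" if "i < 2 * n + 1" for i
    using edge_Suc[OF sn, of "Suc i"] that len by (simp add: s_def nth_append)
  moreover have "edge C s (Suc (Suc i)) (2 * n + 2) = path_comp C (Cod C (hs ! i)) (drop (Suc i) hs)"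
    if "i < 2 * n + 1" for i
    using decomp_edge[of "Suc i"] that len by (simp add: s_def nth_append)
  moreover have "edge C s 1 (2 * n + 2) = path_comp C (Cod C a) hs"
    using decomp_edge[of 0] by (simp add: s_def)
  moreover have "vertex C s (Suc (Suc i)) = Cod C (hs ! i)" if "i < 2 * n + 1" for i
    using that len by (simp add: s_def nth_append)
  ultimately show ?thesis
    using len by (simp add: E_tail[OF s] fiber_chain_def diagram_chain_def fibers_conv_nth)
qed

end

end

context blow_up_category
begin

lemma segal_expanded: "segal E"
  unfolding segal_def
proof (intro allI bij_betwI')
  fix n
  let ?F = "\<lambda>s. (sedge E (Suc n) 0 1 s, act E n (Suc n) Suc s)"
  let ?P = "{(e, s). e \<in> Simp E 1 \<and> s \<in> Simp E n \<and> svertex E 1 1 e = svertex E n 0 s}"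
  have F: "?F (x, a # hs @ [t]) =
      ((x, [a, path_comp C (Cod C a) hs, t]), (fobj \<Phi> (path_comp C (Cod C a) hs), fibers C \<Phi> hs))"
    if "(x, a # hs @ [t]) \<in> Simp E (Suc n)" "length hs = 2 * n + 1" for x a hs t
    using decomp_first_edge[OF that] decomp_tail[OF that] by simp
  show "?F s \<in> ?P" if s: "s \<in> Simp E (Suc n)" for s
  proof -
    have "delta_map n (Suc n) Suc" "delta_map 1 (Suc n) (\<lambda>t. if t = 0 then 0 else 1)"
      by (rule delta_Suc, rule delta_edge) simp_all
    then have in_E: "sedge E (Suc n) 0 1 s \<in> Simp E 1" "act E n (Suc n) Suc s \<in> Simp E n"
      unfolding sedge_def by (blast intro: act_simp[OF simplicial_set_expanded] s)+
    obtain x a hs t where d: "s = (x, a # hs @ [t])" "length hs = 2 * n + 1"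
      using s by (rule simp_decomp)
    note e = decomp_first_edge[OF s[unfolded d(1)] d(2)] decomp_tail[OF s[unfolded d(1)] d(2)]
    \<comment> \<open>Both sides correspond to the fiber of the composite of \<open>hs\<close>: it
      is the target of the first edge and the start of the chain of fibers.\<close>
    have "svertex E 1 1 (sedge E (Suc n) 0 1 s) = svertex E n 0 (act E n (Suc n) Suc s)"
      using target_vertex in_E(1) source_vertex[OF in_E(2)] unfolding d(1) e by simp
    then show ?thesis
      using in_E by simp
  qed
  show "?F s = ?F s' \<longleftrightarrow> s = s'" if s: "s \<in> Simp E (Suc n)" "s' \<in> Simp E (Suc n)" for s s'
  proof
    assume eq: "?F s = ?F s'"
    obtain x a hs t where d: "s = (x, a # hs @ [t])" "length hs = 2 * n + 1"
      using s(1) by (rule simp_decomp)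
    obtain x' a' hs' t' where d': "s' = (x', a' # hs' @ [t'])" "length hs' = 2 * n + 1"
      using s(2) by (rule simp_decomp)
    note in_E = s(1)[unfolded d(1)] s(2)[unfolded d'(1)]
    have xat: "x = x'" "a = a'" "t = t'" and pc: "path_comp C (Cod C a) hs = path_comp C (Cod C a) hs'"
      and fib: "fibers C \<Phi> hs = fibers C \<Phi> hs'"
      using eq unfolding d(1) d'(1) F[OF in_E(1) d(2)] F[OF in_E(2) d'(2)] by auto
    have "hs = hs'"
      using decomp_chain(2)[OF in_E(1) d(2)] decomp_chain(2)[OF in_E(2) d'(2)] pc fib
      unfolding xat(2) by (rule fibers_inj)
    then show "s = s'"
      using xat d d' by simp
  qed simp
  show "\<exists>s\<in>Simp E (Suc n). p = ?F s" if mem: "p \<in> ?P" for p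
  proof -
    obtain e y ps where p: "p = (e, (y, ps))" "e \<in> Simp E 1" "(y, ps) \<in> Simp E n"
        "svertex E 1 1 e = svertex E n 0 (y, ps)"
      using mem by auto
    obtain x a b t where e: "e = (x, [a, b, t])"
      using p(2) by (auto simp: Simp_expanded Simp_undeck nerve_def numeral_3_eq_3 length_Suc_conv)
    have "chain C x [a, b, t]" "Cod C t \<in> T"
      using p(2) e by (auto simp: Simp_expanded Simp_undeck nerve_def)
    then have abt: "a \<in> Arr C" "Dom C a = x" "b \<in> Arr C" "Dom C b = Cod C a" "t \<in> Arr C" "Dom C t = Cod C b"
        "Cod C t \<in> T" "Cod C t \<in> Obj C"
      by auto
    \<comment> \<open>The matching condition says where the lifting can start: at the middle arrow
      \<open>b\<close> of \<open>e\<close>.\<close>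
    have "y = fobj \<Phi> b"
      using p e target_vertex source_vertex[OF p(3)] by (simp add: ex_obj_def)
    then have "chain C (fobj \<Phi> b) ps" "vertex C (fobj \<Phi> b, ps) (length ps) \<in> T" "length ps = 2 * n + 1"
      using p(3) by (auto simp: Simp_expanded Simp_undeck nerve_def simp del: vertex.simps)
    then obtain hs where hs: "chain C (Dom C b) hs" "path_comp C (Dom C b) hs = b" "fibers C \<Phi> hs = ps"
        "length hs = 2 * n + 1"
      using fibers_lift[OF abt(3)] length_fibers by metis
    let ?s = "(x, a # hs @ [t])"
    \<comment> \<open>The lift \<open>hs\<close> subdivides \<open>b\<close>, so it fits between
      \<open>a\<close> and \<open>t\<close>.\<close>
    have "chain C x (a # hs @ [t])"
      using abt hs path_comp_in_hom[OF hs(1)] by (auto simp: chain_append hom_def simp del: vertex.simps)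
    then have s: "?s \<in> Simp E (Suc n)"
      using hs(4) abt by (simp add: Simp_expanded Simp_undeck nerve_def nth_append)
    have "p = ?F ?s"
      unfolding F[OF s hs(4)] using hs abt e p(1) \<open>y = fobj \<Phi> b\<close> by simp
    with s show ?thesis by blast
  qed
qed

section \<open>Morphisms of the expanded category and their factorization\<close>

sublocale segal_sset E "Obj C" "ex_obj C T"
  by unfold_locales (rule simplicial_set_expanded segal_expanded bij_ex_obj)+

text \<open>The third arrow is forced to be \<open>tau\<close>, so a morphism amounts to a
  composable pair of arrows of \<open>C\<close>.\<close>

lemma Arr_D_iff:
  "m \<in> Arr D \<longleftrightarrow> (\<exists>x y w a b. m = (x, [a, b, tau C T w]) \<and> a \<in> hom C x y \<and> b \<in> hom C y w)"
  (is "_ \<longleftrightarrow> ?R")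
proof
  assume "m \<in> Arr D"
  then have m: "m \<in> Simp E 1" by (simp add: segal_cat_def)
  then obtain x a b t where "m = (x, [a, b, t])" "chain C x [a, b, t]" "Cod C t \<in> T"
    by (auto simp: Simp_expanded Simp_undeck nerve_def numeral_3_eq_3 length_Suc_conv)
  then show ?R
    using tau_eq[of t "Cod C b" "Cod C t"] by (fastforce simp: hom_def)
next
  assume ?R
  then obtain x y w a b where m: "m = (x, [a, b, tau C T w])" "a \<in> hom C x y" "b \<in> hom C y w"
    by blast
  have "w \<in> Obj C" using m by (auto simp: hom_def Cod_in_Obj)
  then obtain u where "u \<in> T" "tau C T w \<in> hom C w u" by (rule tau_hom)
  with m show "m \<in> Arr D"
    by (auto simp: segal_cat_def Simp_expanded Simp_undeck nerve_def hom_def Cod_in_Obj)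
qed

lemma arrow_in_hom:
  assumes "a \<in> hom C x y" "b \<in> hom C y w"
  shows "(x, [a, b, tau C T w]) \<in> hom D x (fobj \<Phi> b)"
proof -
  let ?m = "(x, [a, b, tau C T w])"
  have m: "?m \<in> Simp E 1" using assms Arr_D_iff[of ?m] by (auto simp: segal_cat_def)
  have "x \<in> Obj C" "fobj \<Phi> b \<in> Obj C"
    using assms by (auto simp: hom_def Dom_in_Obj fiber_Obj)
  then show ?thesis
    using source_vertex[OF m] target_vertex[OF m] m by (simp add: hom_D lab_ob)
qed

lemma Ident_chosen: "u \<in> T \<Longrightarrow> Ident C u = tau C T u"
  using chosen Ident_in_hom[of u] by (intro tau_eq) (auto simp: chosen_local_terminals_def)

text \<open>The degeneracy s_2 repeats the end \<open>u\<close>; its identity is written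
  \<open>tau C T u\<close> to fit the normal form of \<open>Arr_D_iff\<close>.\<close>

lemma ex_arr_eq:
  assumes "g \<in> hom C y z" "tau C T z \<in> hom C z u" "u \<in> T"
  shows "ex_arr C T \<Phi> g = (y, [g, tau C T z, tau C T u])"
proof -
  have "ex_arr C T \<Phi> g = degen (nerve C) 2 2 (y, [g, tau C T z])"
    using assms by (simp add: ex_arr_def undeck_degen hom_def)
  then show ?thesis
    using assms by (simp add: degen_def nerve_def codeg_def edge_def eval_nat_numeral Ident_chosen[symmetric] hom_def)
qed

lemma ex_angle_eq:
  assumes "f \<in> hom C x w"
  shows "ex_angle C T \<Phi> f = (x, [Ident C x, f, tau C T w])"
proof -
  have "ex_angle C T \<Phi> f = degen (nerve C) 2 0 (x, [f, tau C T w])"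
    using assms by (simp add: ex_angle_def undeck_degen hom_def)
  then show ?thesis
    by (simp add: degen_def nerve_def codeg_def edge_def eval_nat_numeral)
qed

text \<open>The middle arrow is \<open>tau C T z\<close>, whose fiber is \<open>z\<close> by
  (U2).\<close>

lemma ex_arr_in_hom:
  assumes "g \<in> hom C y z"
  shows "ex_arr C T \<Phi> g \<in> hom D y z"
proof -
  have z: "z \<in> Obj C" using assms by (auto simp: hom_def Cod_in_Obj)
  then obtain u where u: "u \<in> T" "tau C T z \<in> hom C z u" by (rule tau_hom)
  show ?thesis
    using arrow_in_hom[OF assms u(2)] ex_arr_eq[OF assms u(2,1)] z by (simp add: U2_obj)
qed

lemma ex_angle_in_hom:
  assumes "f \<in> hom C x w"
  shows "ex_angle C T \<Phi> f \<in> hom D x (fobj \<Phi> f)"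
proof -
  have "x \<in> Obj C" using assms by (auto simp: hom_def Dom_in_Obj)
  then show ?thesis
    using arrow_in_hom[OF Ident_in_hom assms] ex_angle_eq[OF assms] by simp
qed

text \<open>The $2$-simplex witnessing the composite is $x = x \to y \to w = w \to u$.\<close>

lemma Comp_ex_arr_ex_angle:
  assumes a: "a \<in> hom C x y" and b: "b \<in> hom C y w"
  shows "Comp D (ex_arr C T \<Phi> (farr \<Phi> (a, b))) (ex_angle C T \<Phi> (Comp C b a)) = (x, [a, b, tau C T w])"
proof -
  let ?s = "(x, [Ident C x, a, b, Ident C w, tau C T w])"
  have xw: "x \<in> Obj C" "y \<in> Obj C" "w \<in> Obj C"
    using a b by (auto simp: hom_def Dom_in_Obj Cod_in_Obj)
  note ids = Ident_in_hom[OF xw(1)] Ident_in_hom[OF xw(3)]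
  obtain u where u: "u \<in> T" "tau C T w \<in> hom C w u" using xw(3) by (rule tau_hom)
  have ba: "Comp C b a \<in> hom C x w" using a b by (rule Comp_in_hom)
  have sX: "?s \<in> Simp X 5"
    using a b u ids by (auto simp: Simp_undeck nerve_def hom_def Cod_in_Obj)
  then have s: "?s \<in> Simp E 2" by (simp add: Simp_expanded)
  \<comment> \<open>Edges from vertex 0 use position 5, the end of the chain, and are therefore
    computed in the nerve.\<close>
  have top: "sedge E 2 0 j ?s = act (nerve C) 3 5 ((!) [0, j, 5 - j, 5]) ?s" if "j \<le> 2" for j
  proof -
    have "delta_map 3 5 ((!) [0, j, 5 - j, 5])"
      using that by (intro delta_mapI) (auto simp: le_Suc_eq eval_nat_numeral)
    then show ?thesis
      using E_edge[OF s, of 0 j] that fiber_chain_top[OF sX] by (simp add: eval_nat_numeral)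
  qed
  have vs: "Cod C (Ident C x) = x" "Cod C a = y" "Cod C b = w" "Cod C (Ident C w) = w"
    using a b ids by (auto simp: hom_def)
  note [simp] = vs Comp_Ident_left[OF a] Comp_Ident_left[OF b] Comp_Ident_right[OF a] Comp_Ident_right[OF b]
    Comp_Ident_left[OF ba] Comp_Ident_right[OF u(2)]
  have "sedge E 2 0 1 ?s = ex_angle C T \<Phi> (Comp C b a)"
    using top[of 1] by (simp add: nerve_def edge_def eval_nat_numeral ex_angle_eq[OF ba])
  moreover have "sedge E 2 0 2 ?s = (x, [a, b, tau C T w])"
    using top[of 2] by (simp add: nerve_def edge_def eval_nat_numeral)
  \<comment> \<open>This edge uses the positions 1, 2, 3, 4, so fibers are taken over the second
    copy of \<open>w\<close>. Its last two arrows end in \<open>T\<close> by (U1), hence are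
    \<open>tau\<close>, as in \<open>ex_arr_eq\<close>.\<close>
  moreover have "sedge E 2 1 2 ?s = ex_arr C T \<Phi> (farr \<Phi> (a, b))"
  proof -
    let ?z = "fobj \<Phi> b" and ?v = "fobj \<Phi> (Ident C w)"
    have g: "farr \<Phi> (a, b) \<in> hom C (fobj \<Phi> (Comp C b a)) ?z"
      using fiber_hom[OF a b] .
    have z: "farr \<Phi> (b, Ident C w) \<in> hom C ?z ?v" and v: "?v \<in> T"
      using fiber_hom[OF b ids(2)] U1 xw by auto
    have v': "farr \<Phi> (Ident C w, Ident C w) = tau C T ?v"
      using fiber_Ident[OF ids(2)] Ident_chosen[OF v] by simp
    have z': "farr \<Phi> (b, Ident C w) = tau C T ?z"
      using z v by (rule tau_eq)
    have "sedge E 2 1 2 ?s = (fobj \<Phi> (Comp C b a),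
        [farr \<Phi> (a, b), farr \<Phi> (b, Ident C w), farr \<Phi> (Ident C w, Ident C w)])"
      using E_edge[OF s, of 1 2]
      by (simp add: fiber_chain_def diagram_chain_def edge_def eval_nat_numeral)
    then show ?thesis
      using ex_arr_eq[OF g _ v] z v' z' by simp
  qed
  ultimately show ?thesis
    using Comp_sedge[OF s, of 0 1 2] by simp
qed

text \<open>The pair belonging to (a, b) is (ba, phi(a, b)). Conversely, an admissible (f, g) lifts
  to a factorization f = hk with fiber map g, and \<open>Comp_ex_arr_ex_angle\<close> recovers k and
  h as the first two arrows of the chain \<open>m\<close>.\<close>

lemma unique_factorization:
  assumes "m \<in> hom D x z"
  shows "\<exists>!p. case p of (f, g) \<Rightarrow> f \<in> Arr C \<and> Dom C f = x \<and> g \<in> hom C (fobj \<Phi> f) z \<and>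
    m = Comp D (ex_arr C T \<Phi> g) (ex_angle C T \<Phi> f)"
proof -
  obtain y w a b where m: "m = (x, [a, b, tau C T w])" and ab: "a \<in> hom C x y" "b \<in> hom C y w"
    and z: "z = fobj \<Phi> b"
    using assms Arr_D_iff[of m] arrow_in_hom by (fastforce simp: hom_def)
  show ?thesis
  proof (rule ex1I[of _ "(Comp C b a, farr \<Phi> (a, b))"])
    show "case (Comp C b a, farr \<Phi> (a, b)) of (f, g) \<Rightarrow> f \<in> Arr C \<and> Dom C f = x \<and>
        g \<in> hom C (fobj \<Phi> f) z \<and> m = Comp D (ex_arr C T \<Phi> g) (ex_angle C T \<Phi> f)"
      using Comp_in_hom[OF ab] fiber_hom[OF ab] Comp_ex_arr_ex_angle[OF ab] m z by (auto simp: hom_def)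
  next
    fix p
    assume "case p of (f, g) \<Rightarrow> f \<in> Arr C \<and> Dom C f = x \<and>
        g \<in> hom C (fobj \<Phi> f) z \<and> m = Comp D (ex_arr C T \<Phi> g) (ex_angle C T \<Phi> f)"
    then obtain f g where p: "p = (f, g)" and f: "f \<in> Arr C" "Dom C f = x" "g \<in> Arr C" "Dom C g = fobj \<Phi> f"
      and comp: "m = Comp D (ex_arr C T \<Phi> g) (ex_angle C T \<Phi> f)"
      by (auto simp: hom_def)
    obtain k h where kh: "k \<in> Arr C" "h \<in> Arr C" "Cod C k = Dom C h" "Comp C h k = f" "farr \<Phi> (k, h) = g"
      using lift_exists[OF f(1,3,4)] .
    then have "m = (Dom C k, [k, h, tau C T (Cod C h)])"
      using comp Comp_ex_arr_ex_angle[of k "Dom C k" "Cod C k" h "Cod C h"] by (simp add: hom_def)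
    then show "p = (Comp C b a, farr \<Phi> (a, b))"
      using m p kh by simp
  qed
qed

end

theorem theorem1p2:
  fixes C :: "('o, 'a) cat"
    and T :: "'o set"
    and \<Phi> :: "('a, 'a \<times> 'a, 'o, 'a) func"
  assumes "unary_operadic_category C T \<Phi>"
    and "blow_up C \<Phi>"
  shows "\<exists>(D :: ('o, 'o \<times> 'a list) cat) \<theta>.
    category D \<and> sset_iso (nerve D) (expanded C T \<Phi>) \<theta> \<and>
    Obj D = Obj C \<and> (\<forall>x\<in>Obj C. \<theta> 0 (x, []) = ex_obj C T x) \<and>
    Arr D = Simp (expanded C T \<Phi>) 1 \<and> (\<forall>m\<in>Arr D. \<theta> 1 (Dom D m, [m]) = m) \<and>
    (\<forall>g\<in>Arr C. ex_arr C T \<Phi> g \<in> hom D (Dom C g) (Cod C g)) \<and>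
    (\<forall>f\<in>Arr C. ex_angle C T \<Phi> f \<in> hom D (Dom C f) (fobj \<Phi> f)) \<and>
    (\<forall>x\<in>Obj C. \<forall>z\<in>Obj C. \<forall>m\<in>hom D x z.
       \<exists>!p. case p of (f, g) \<Rightarrow>
         f \<in> Arr C \<and> Dom C f = x \<and> g \<in> hom C (fobj \<Phi> f) z \<and>
         m = Comp D (ex_arr C T \<Phi> g) (ex_angle C T \<Phi> f))"
proof -
  interpret blow_up_category C T \<Phi>
    using assms by (simp add: blow_up_category_def blow_up_category_axioms_def)
  have Arr: "Arr D = Simp E 1" by (simp add: segal_cat_def)
  have hom: "f \<in> hom C (Dom C f) (Cod C f)" if "f \<in> Arr C" for f
    using that by (simp add: hom_def)
  show ?thesis
    by (intro exI[of _ D] exI[of _ unspine] conjI ballI)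
      (simp_all only: category_D sset_iso_unspine Obj_D unspine_object Arr unspine_arrow[unfolded Arr]
        ex_arr_in_hom[OF hom] ex_angle_in_hom[OF hom] unique_factorization)
qed

end
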